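(* Let $M$ be a non-degenerate rotational surface in the Minkowski space $\mathbf{E}_1^3$, and take $\epsilon=1$ if $M$ is spacelike and $\epsilon=-1$ if $M$ is timelike. Assume that $M$ is a linear Weingarten surface, i.e. $aH+bK=c$ on $M$ for constants $a,b,c$, where $H$ and $K$ are the mean curvature and the Gauss curvature of $M$ (the cases that $H$ is constant or $K$ is constant being discarded), such that $a^2-4bc\epsilon=0$. After a rigid motion of the ambient space, a parametrization $X(u,v)$ of $M$ is as follows: 1. If the axis is timelike, $X(u,v)=(u\cos(v),u\sin(v),z(u))$, where $$z(u)=\pm\sqrt{\frac{4\epsilon b^2}{a^2}+\Big(\frac{C}{a}\pm u\Big)^2}+\mu,\qquad C=2\sqrt{b\epsilon(-b+\lambda)},\quad \mu,\lambda\in\mathbb{R}.$$ 2. If the axis is spacelike, we have two possibilities: (a) The parametrization is $X(u,v)=(u,z(u)\sinh(v),z(u)\cosh(v))$, where $$z(u)=\pm\frac{C}{a}\pm\sqrt{\frac{4\epsilon b^2}{a^2}\pm(u\pm\mu)^2},\qquad C=2\sqrt{b\epsilon\lambda},\quad \mu,\lambda\in\mathbb{R}.$$ (b) The parametrization is $X(u,v)=(u,z(u)\cosh(v),z(u)\sinh(v))$, where $$z(u)=\frac{-C}{a}\pm\sqrt{\frac{4b^2}{a^2}\pm(u\pm\mu)^2},\qquad C=2\sqrt{b\lambda},\quad \mu,\lambda\in\mathbb{R}.$$ 3. If the axis is lightlike, $X(u,v)=(-2uv,\,z(u)+u-uv^2,\,z(u)-u-uv^2)$, where $$z(u)=\frac{1}{48}\left(\frac{-4ac\lambda+(cC^2-2a^2\lambda)u}{\epsilon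 c\lambda(2\lambda+cu^2)}+\epsilon\,\frac{cC^2+2a^2\lambda}{\sqrt{-2c\lambda}}\,\operatorname{arctanh}\Big(\sqrt{-\frac{c}{2\lambda}}\;u\Big)\right)+\mu,\qquad \mu,\lambda\in\mathbb{R},$$ with $C=\sqrt{-8b\epsilon\lambda}$.
   Context: $\mathbf{E}_1^3$ is $\mathbb{R}^3$ with the Lorentzian metric $\langle\,,\rangle=(dx)^2+(dy)^2-(dz)^2$. A vector $v$ is spacelike if $\langle v,v\rangle>0$ or $v=0$, timelike if $\langle v,v\rangle<0$, and lightlike if $\langle v,v\rangle=0$ and $v\neq0$; a straight line has the causal character of its direction vector. An immersed surface is non-degenerate if the induced metric is non-degenerate; it is spacelike if the induced metric is Riemannian (positive definite) and timelike if it is Lorentzian (index 1). Surfaces are oriented by a unit normal field $N$ (spacelike surfaces are automatically orientable; timelike ones are assumed orientable). Curvatures. For a parametrization $X(u,v)$ let $E=\langle X_u,X_u\rangle$, $F=\langle X_u,X_v\rangle$, $G=\langle X_v,X_v\rangle$, $e=-\langle N_u,X_u\rangle$, $f=-\langle N_u,X_v\rangle$, $g=-\langle N_v,X_v\rangle$, with $N=\dfrac{X_u\times X_v}{\sqrt{\epsilon(EG-F^2)}}$, where $\times$ is determined by $\langle u\times v,w\rangle=\det(u,v,w)$. Then $$H=-\frac{\epsilon}{2}\,\frac{eG-2fF+gE}{EG-F^2},\qquad K=-\epsilon\,\frac{eg-f^2}{EG-F^2}.$$ Rotational surfaces. A rotational surface (surface of revolution) with axis a line $L$ is a surface invariant under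 a group of rigid motions of $\mathbf{E}_1^3$ that leave $L$ pointwise fixed. After an isometry, these groups $\{R_v\}_{v\in\mathbb{R}}$ are given, in the canonical basis $e_1,e_2,e_3$ and acting on column vectors, by: - timelike axis $L=\langle e_3\rangle$: $\begin{pmatrix}\cos v&\sin v&0\\-\sin v&\cos v&0\\0&0&1\end{pmatrix}$; - spacelike axis $L=\langle e_1\rangle$: $\begin{pmatrix}1&0&0\\0&\cosh v&\sinh v\\0&\sinh v&\cosh v\end{pmatrix}$; - lightlike axis $L=\langle(0,1,1)\rangle$: $\begin{pmatrix}1&-v&v\\ v&1-\frac{v^2}{2}&\frac{v^2}{2}\\ v&-\frac{v^2}{2}&1+\frac{v^2}{2}\end{pmatrix}$. Such a surface is the set $\{R_v(\alpha(u)) : u\in I,\ v\in\mathbb{R}\}$ generated by a planar curve $\alpha$, taken as a graph of a function $z=z(u)$, $u\neq0$: for a timelike axis $\alpha(u)=(u,0,z(u))$; for a spacelike axis $\alpha(u)=(u,0,z(u))$ (possibility (a)) or $\alpha(u)=(u,z(u),0)$ (possibility (b), in which the surface is timelike); for a lightlike axis $\alpha(u)=(0,u+z(u),-u+z(u))$.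
   Formalization: In item 3 two misprints are corrected: the prefactor 1/48 is replaced by 1/64 and the term −4acλ by −4aCλ (as printed the formula fails, e.g. ε=b=c=1, a=2, z=−1/(2(2u−1))); the formula is asserted where 2λ+cu²≠0. *)

theory Defs
  imports "HOL-Analysis.Analysis"
begin

section \<open>Minkowski space $\mathbf{E}_1^3$\<close>

type_synonym vec3 = "real^3"

definition lor :: "vec3 \<Rightarrow> vec3 \<Rightarrow> real" where
  "lor x y = x$1 * y$1 + x$2 * y$2 - x$3 * y$3"

definition spacelike_vec :: "vec3 \<Rightarrow> bool" where
  "spacelike_vec x \<longleftrightarrow> lor x x > 0 \<or> x = 0"

definition timelike_vec :: "vec3 \<Rightarrow> bool" where
  "timelike_vec x \<longleftrightarrow> lor x x < 0"

definition lightlike_vec :: "vec3 \<Rightarrow> bool" where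
  "lightlike_vec x \<longleftrightarrow> lor x x = 0 \<and> x \<noteq> 0"

definition line_with_direction :: "vec3 set \<Rightarrow> vec3 \<Rightarrow> bool" where
  "line_with_direction L d \<longleftrightarrow> d \<noteq> 0 \<and> (\<exists>p. L = range (\<lambda>t. p + t *\<^sub>R d))"

definition spacelike_line :: "vec3 set \<Rightarrow> bool" where
  "spacelike_line L \<longleftrightarrow> (\<exists>d. line_with_direction L d \<and> spacelike_vec d)"

definition timelike_line :: "vec3 set \<Rightarrow> bool" where
  "timelike_line L \<longleftrightarrow> (\<exists>d. line_with_direction L d \<and> timelike_vec d)"

definition lightlike_line :: "vec3 set \<Rightarrow> bool" where
  "lightlike_line L \<longleftrightarrow> (\<exists>d. line_with_direction L d \<and> lightlike_vec d)"

text \<open>Rigid motions are all isometries of the ambient space: the full group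
  $O_1(3) \ltimes \mathbb{R}^3$, with no condition on orientation or time orientation.\<close>

definition rigid_motion :: "(vec3 \<Rightarrow> vec3) \<Rightarrow> bool" where
  "rigid_motion T \<longleftrightarrow>
     (\<exists>(A :: real^3^3) t. (\<forall>x y. lor (A *v x) (A *v y) = lor x y) \<and> T = (\<lambda>x. A *v x + t))"

definition lcross :: "vec3 \<Rightarrow> vec3 \<Rightarrow> vec3" where
  "lcross x y = vector [x$2 * y$3 - x$3 * y$2, x$3 * y$1 - x$1 * y$3, - (x$1 * y$2 - x$2 * y$1)]"

lemma lor_lcross: "lor (lcross x y) w = det (vector [x, y, w] :: real^3^3)"
  by (simp add: lor_def lcross_def det_3 algebra_simps)

lemma lcross_unique:
  assumes "\<And>w. lor n w = det (vector [x, y, w] :: real^3^3)"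
  shows "n = lcross x y"
proof -
  have *: "lor n w = lor (lcross x y) w" for w
    by (simp add: assms lor_lcross)
  show ?thesis
    using *[of "vector [1,0,0]"] *[of "vector [0,1,0]"] *[of "vector [0,0,1]"]
    by (simp add: lor_def vec_eq_iff forall_3)
qed

section \<open>Geometry of a parametrized surface\<close>

definition Xu :: "(real \<Rightarrow> real \<Rightarrow> vec3) \<Rightarrow> real \<Rightarrow> real \<Rightarrow> vec3" where
  "Xu X u v = vector_derivative (\<lambda>s. X s v) (at u)"

definition Xv :: "(real \<Rightarrow> real \<Rightarrow> vec3) \<Rightarrow> real \<Rightarrow> real \<Rightarrow> vec3" where
  "Xv X u v = vector_derivative (\<lambda>s. X u s) (at v)"

definition ffE :: "(real \<Rightarrow> real \<Rightarrow> vec3) \<Rightarrow> real \<Rightarrow> real \<Rightarrow> real" where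
  "ffE X u v = lor (Xu X u v) (Xu X u v)"

definition ffF :: "(real \<Rightarrow> real \<Rightarrow> vec3) \<Rightarrow> real \<Rightarrow> real \<Rightarrow> real" where
  "ffF X u v = lor (Xu X u v) (Xv X u v)"

definition ffG :: "(real \<Rightarrow> real \<Rightarrow> vec3) \<Rightarrow> real \<Rightarrow> real \<Rightarrow> real" where
  "ffG X u v = lor (Xv X u v) (Xv X u v)"

text \<open>The induced metric in coordinates: \<^term>\<open>ind_metric X u v (s, t) (s', t')\<close> is the product of the
  tangent vectors $s X_u + t X_v$ and $s' X_u + t' X_v$.  Working with coordinates, non-degeneracy
  includes that $X_u, X_v$ are linearly independent, i.e. that $X$ is an immersion.\<close>

definition ind_metric ::
  "(real \<Rightarrow> real \<Rightarrow> vec3) \<Rightarrow> real \<Rightarrow> real \<Rightarrow> real \<times> real \<Rightarrow> real \<times> real \<Rightarrow> real" where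
  "ind_metric X u v p q = ffE X u v * fst p * fst q
     + ffF X u v * (fst p * snd q + snd p * fst q) + ffG X u v * snd p * snd q"

definition nondegenerate_surface :: "(real \<Rightarrow> real \<Rightarrow> vec3) \<Rightarrow> (real \<times> real) set \<Rightarrow> bool" where
  "nondegenerate_surface X D \<longleftrightarrow>
     (\<forall>(u, v)\<in>D. \<forall>p. (\<forall>q. ind_metric X u v p q = 0) \<longrightarrow> p = 0)"

definition spacelike_surface :: "(real \<Rightarrow> real \<Rightarrow> vec3) \<Rightarrow> (real \<times> real) set \<Rightarrow> bool" where
  "spacelike_surface X D \<longleftrightarrow> (\<forall>(u, v)\<in>D. \<forall>p. p \<noteq> 0 \<longrightarrow> ind_metric X u v p p > 0)"

text \<open>A non-degenerate form on a plane has index 1 iff it takes both signs.\<close>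

definition timelike_surface :: "(real \<Rightarrow> real \<Rightarrow> vec3) \<Rightarrow> (real \<times> real) set \<Rightarrow> bool" where
  "timelike_surface X D \<longleftrightarrow> nondegenerate_surface X D \<and>
     (\<forall>(u, v)\<in>D. (\<exists>p. ind_metric X u v p p < 0) \<and> (\<exists>p. ind_metric X u v p p > 0))"

text \<open>Below, \<open>\<epsilon>\<close> is 1 for spacelike and $-1$ for timelike surfaces.\<close>

definition normal :: "real \<Rightarrow> (real \<Rightarrow> real \<Rightarrow> vec3) \<Rightarrow> real \<Rightarrow> real \<Rightarrow> vec3" where
  "normal \<epsilon> X u v =
     (1 / sqrt (\<epsilon> * (ffE X u v * ffG X u v - (ffF X u v)\<^sup>2))) *\<^sub>R lcross (Xu X u v) (Xv X u v)"

definition sfe :: "real \<Rightarrow> (real \<Rightarrow> real \<Rightarrow> vec3) \<Rightarrow> real \<Rightarrow> real \<Rightarrow> real" where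
  "sfe \<epsilon> X u v = - lor (Xu (normal \<epsilon> X) u v) (Xu X u v)"

definition sff :: "real \<Rightarrow> (real \<Rightarrow> real \<Rightarrow> vec3) \<Rightarrow> real \<Rightarrow> real \<Rightarrow> real" where
  "sff \<epsilon> X u v = - lor (Xu (normal \<epsilon> X) u v) (Xv X u v)"

definition sfg :: "real \<Rightarrow> (real \<Rightarrow> real \<Rightarrow> vec3) \<Rightarrow> real \<Rightarrow> real \<Rightarrow> real" where
  "sfg \<epsilon> X u v = - lor (Xv (normal \<epsilon> X) u v) (Xv X u v)"

definition mean_curvature :: "real \<Rightarrow> (real \<Rightarrow> real \<Rightarrow> vec3) \<Rightarrow> real \<Rightarrow> real \<Rightarrow> real" where
  "mean_curvature \<epsilon> X u v = - (\<epsilon> / 2) *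
     ((sfe \<epsilon> X u v * ffG X u v - 2 * sff \<epsilon> X u v * ffF X u v + sfg \<epsilon> X u v * ffE X u v)
      / (ffE X u v * ffG X u v - (ffF X u v)\<^sup>2))"

definition gauss_curvature :: "real \<Rightarrow> (real \<Rightarrow> real \<Rightarrow> vec3) \<Rightarrow> real \<Rightarrow> real \<Rightarrow> real" where
  "gauss_curvature \<epsilon> X u v = - \<epsilon> *
     ((sfe \<epsilon> X u v * sfg \<epsilon> X u v - (sff \<epsilon> X u v)\<^sup>2)
      / (ffE X u v * ffG X u v - (ffF X u v)\<^sup>2))"

text \<open>The coefficients of a linear Weingarten relation are not all zero; as \<open>a = b = 0\<close>
  forces \<open>c = 0\<close>, this means \<open>(a, b) \<noteq> (0, 0)\<close>.\<close>

definition linear_weingarten ::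
  "real \<Rightarrow> real \<Rightarrow> real \<Rightarrow> real \<Rightarrow> (real \<Rightarrow> real \<Rightarrow> vec3) \<Rightarrow> (real \<times> real) set \<Rightarrow> bool" where
  "linear_weingarten \<epsilon> a b c X D \<longleftrightarrow> (a \<noteq> 0 \<or> b \<noteq> 0) \<and>
     (\<forall>(u, v)\<in>D. a * mean_curvature \<epsilon> X u v + b * gauss_curvature \<epsilon> X u v = c)"

section \<open>Rotational surfaces\<close>

definition rot_timelike :: "real \<Rightarrow> real^3^3" where
  "rot_timelike v = vector [vector [cos v, sin v, 0], vector [- sin v, cos v, 0], vector [0, 0, 1]]"

definition rot_spacelike :: "real \<Rightarrow> real^3^3" where
  "rot_spacelike v =
     vector [vector [1, 0, 0], vector [0, cosh v, sinh v], vector [0, sinh v, cosh v]]"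

definition rot_lightlike :: "real \<Rightarrow> real^3^3" where
  "rot_lightlike v =
     vector [vector [1, - v, v],
             vector [v, 1 - v\<^sup>2 / 2, v\<^sup>2 / 2],
             vector [v, - (v\<^sup>2 / 2), 1 + v\<^sup>2 / 2]]"

text \<open>The function whose graph generates the surface: of class $C^2$ on a nonempty open interval,
  which is all that the curvatures need.\<close>

definition profile :: "real set \<Rightarrow> (real \<Rightarrow> real) \<Rightarrow> bool" where
  "profile I z \<longleftrightarrow> open I \<and> is_interval I \<and> I \<noteq> {} \<and>
     z differentiable_on I \<and> deriv z differentiable_on I \<and> continuous_on I (deriv (deriv z))"

text \<open>\<open>X\<close>, on \<open>I \<times> \<real>\<close>, parametrizes a rotational surface with axis \<open>L\<close>: it is the image under an
  isometry \<open>\<Phi>\<close> of one of the surfaces $R_v(\alpha(u))$ about a canonical axis.  The usual requirement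
  $u \neq 0$ is not repeated here: about a timelike or lightlike axis $X_v$ vanishes at $u = 0$, so
  non-degeneracy implies it, and about a spacelike axis it is not needed.
  As \<open>\<Phi>\<close> may reverse orientation, both choices of the unit normal field of a given surface
  arise from such parametrizations.\<close>

definition rotational_surface :: "vec3 set \<Rightarrow> real set \<Rightarrow> (real \<Rightarrow> real \<Rightarrow> vec3) \<Rightarrow> bool" where
  "rotational_surface L I X \<longleftrightarrow> (\<exists>\<Phi> z. rigid_motion \<Phi> \<and> profile I z \<and>
     ((L = \<Phi> ` span {vector [0, 0, 1]} \<and>
         (\<forall>u\<in>I. \<forall>v. X u v = \<Phi> (rot_timelike v *v vector [u, 0, z u]))) \<or>
      (L = \<Phi> ` span {vector [1, 0, 0]} \<and>
         (\<forall>u\<in>I. \<forall>v. X u v = \<Phi> (rot_spacelike v *v vector [u, 0, z u]))) \<or>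
      (L = \<Phi> ` span {vector [1, 0, 0]} \<and>
         (\<forall>u\<in>I. \<forall>v. X u v = \<Phi> (rot_spacelike v *v vector [u, z u, 0]))) \<or>
      (L = \<Phi> ` span {vector [0, 1, 1]} \<and>
         (\<forall>u\<in>I. \<forall>v. X u v = \<Phi> (rot_lightlike v *v vector [0, u + z u, - u + z u])))))"

definition surface_of :: "real set \<Rightarrow> (real \<Rightarrow> real \<Rightarrow> vec3) \<Rightarrow> vec3 set" where
  "surface_of I X = {X u v | u v. u \<in> I}"

end

theory Submission
  imports Defs
begin

text \<open>
  Up to an isometry the surface is swept out by a meridian curve, in coordinates for which the first
  fundamental form is diagonal and depends on \<open>u\<close> only.  The meridian and the parallel directions are
  principal: \<open>N\<^sub>u = \<epsilon> \<kappa>1 X\<^sub>u\<close> and \<open>N\<^sub>v = \<epsilon> \<kappa>2 X\<^sub>v\<close>, so that \<open>H = (\<kappa>1 + \<kappa>2) / 2\<close> and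
  \<open>K = - \<epsilon> \<kappa>1 \<kappa>2\<close>.  When \<open>a\<^sup>2 = 4 b c \<epsilon>\<close>, the relation \<open>a H + b K = c\<close> factors as
  \<open>(\<kappa>1 - p) (\<kappa>2 - p) = 0\<close> with \<open>p = \<epsilon> a / (2 b)\<close>.

  Let \<open>r\<close> be the radius function of the parallels (\<open>u\<close> or \<open>z\<close>, according to the axis).  The Codazzi
  equation \<open>(r \<kappa>2)' = r' \<kappa>1\<close> says that \<open>y = r (\<kappa>2 - p)\<close> has derivative \<open>r' (\<kappa>1 - p)\<close>.
  Hence \<open>(y\<^sup>2)' = 2 r r' (\<kappa>1 - p) (\<kappa>2 - p) = 0\<close>, and \<open>y\<close> vanishes either everywhere or nowhere.  In
  the former case \<open>\<kappa>2 = p\<close>, and the continuous function \<open>\<kappa>1\<close> takes at most the values \<open>0\<close> and \<open>p\<close>,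
  so that \<open>K\<close> is constant, which is excluded.  In the latter case \<open>\<kappa>1 = p\<close> throughout (\<open>constant_meridian_curvature\<close>): the meridian has constant
  curvature.

  About a timelike or a spacelike axis the meridian is therefore an arc of a conic
  \<open>(z - z0)\<^sup>2 = \<plusminus> 1 / p\<^sup>2 \<plusminus> (u - u0)\<^sup>2\<close> (\<open>constant_curvature_arc\<close>), with \<open>1 / p\<^sup>2 = 4 b\<^sup>2 / a\<^sup>2\<close>.  About a
  lightlike axis \<open>1 / \<surd>(\<epsilon> z')\<close> is affine in \<open>u\<close>, and \<open>z = z0 - \<epsilon> b\<^sup>2 / (a\<^sup>2 (u - u0))\<close>.  It remains to
  express \<open>u0\<close> and \<open>z0\<close> by \<open>C\<close>, \<open>\<lambda>\<close> and \<open>\<mu>\<close>, where a sign may have to be absorbed in the rigid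
  motion.  About a lightlike axis, the constants are such that the coefficient of the inverse
  hyperbolic tangent vanishes.
\<close>

section \<open>Linear isometries of Minkowski space\<close>

lemma vec3_eq_iff: "(x :: vec3) = y \<longleftrightarrow> x$1 = y$1 \<and> x$2 = y$2 \<and> x$3 = y$3"
  by (simp add: vec_eq_iff forall_3)

lemma lor_scale_left: "lor (k *\<^sub>R x) w = k * lor x w"
  and lor_scale_right: "lor x (k *\<^sub>R w) = k * lor x w"
  by (simp_all add: lor_def algebra_simps)

lemma lor_nondegenerate:
  assumes "\<And>w. lor x w = lor y w"
  shows "x = y"
  using assms[of "vector [1,0,0]"] assms[of "vector [0,1,0]"] assms[of "vector [0,0,1]"]
  by (simp add: lor_def vec3_eq_iff)

lemma vector3_matrix:
  "(vector [A *v x, A *v y, A *v w] :: real^3^3) = vector [x, y, w] ** transpose A"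
  by (simp add: vec_eq_iff forall_3 matrix_matrix_mult_def matrix_vector_mult_def transpose_def
      sum_3 mult.commute)

lemma det_rows_matrix:
  "det (vector [A *v x, A *v y, A *v w] :: real^3^3) = det A * det (vector [x, y, w] :: real^3^3)"
  by (simp only: vector3_matrix det_mul det_transpose mult.commute)

text \<open>The matrices of the orthogonal group $O_1(3)$.\<close>

locale lorentz_matrix =
  fixes A :: "real^3^3"
  assumes lor_preserved: "lor (A *v x) (A *v y) = lor x y"
begin

lemma det_squared: "(det A)\<^sup>2 = 1"
proof -
  \<comment> \<open>\<open>J\<close> is the Gram matrix of the metric, and isometries satisfy \<open>A\<^sup>T J A = J\<close>.\<close>
  define J :: "real^3^3" where "J = vector [vector [1,0,0], vector [0,1,0], vector [0,0,-1]]"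
  have J: "lor x y = x \<bullet> (J *v y)" for x y
    by (simp add: lor_def J_def inner_vec_def sum_3 matrix_vector_mult_def)
  have "transpose A ** J ** A = J"
  proof -
    have "x \<bullet> ((transpose A ** J ** A) *v y) = x \<bullet> (J *v y)" for x y
    proof -
      have "x \<bullet> ((transpose A ** J ** A) *v y) = ((J *v (A *v y)) v* A) \<bullet> x"
        by (simp only: matrix_vector_mul_assoc[symmetric] transpose_matrix_vector inner_commute)
      also have "\<dots> = (A *v x) \<bullet> (J *v (A *v y))"
        by (subst dot_lmul_matrix) (rule inner_commute)
      also have "\<dots> = x \<bullet> (J *v y)"
        by (simp only: J[symmetric] lor_preserved)
      finally show ?thesis .
    qed
    then have "(transpose A ** J ** A) *v y = J *v y" for y
      using vector_eq_ldot by blast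
    then show ?thesis
      by (simp add: matrix_eq)
  qed
  then have "det (transpose A ** J ** A) = det J"
    by simp
  then have "det A * det J * det A = det J"
    by (simp only: det_mul det_transpose)
  moreover have "det J = -1"
    unfolding J_def det_3 by simp
  ultimately show ?thesis
    by (simp add: power2_eq_square)
qed

lemma det_cases: "det A = 1 \<or> det A = -1"
  using det_squared by (simp add: power2_eq_1_iff)

lemma invertible: "invertible A"
  using det_cases by (auto simp: invertible_det_nz)

lemma inverse_mult: "A *v (matrix_inv A *v x) = x" "matrix_inv A *v (A *v x) = x"
proof -
  have "A ** matrix_inv A = mat 1 \<and> matrix_inv A ** A = mat 1"
    using invertible unfolding invertible_def matrix_inv_def by (rule someI_ex)
  then show "A *v (matrix_inv A *v x) = x" "matrix_inv A *v (A *v x) = x"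
    by (simp_all add: matrix_vector_mul_assoc)
qed

lemma lorentz_matrix_inv: "lorentz_matrix (matrix_inv A)"
proof
  fix x y
  show "lor (matrix_inv A *v x) (matrix_inv A *v y) = lor x y"
    using lor_preserved[of "matrix_inv A *v x" "matrix_inv A *v y"] by (simp add: inverse_mult)
qed

text \<open>So the unit normal of the image of a surface under \<open>A\<close> is the image of the unit normal times
  \<open>det A\<close>.\<close>

lemma lcross_matrix: "lcross (A *v x) (A *v y) = det A *\<^sub>R (A *v lcross x y)"
proof (rule lor_nondegenerate)
  fix w
  define w' where "w' = matrix_inv A *v w"
  have w: "w = A *v w'"
    by (simp add: w'_def inverse_mult)
  show "lor (lcross (A *v x) (A *v y)) w = lor (det A *\<^sub>R (A *v lcross x y)) w"
    by (simp add: w lor_lcross det_rows_matrix lor_scale_left lor_preserved)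
qed

end

lemma rigid_motion_iff: "rigid_motion T \<longleftrightarrow> (\<exists>A t. lorentz_matrix A \<and> T = (\<lambda>x. A *v x + t))"
  by (simp add: rigid_motion_def lorentz_matrix_def)

lemma rigid_motion_inverse:
  assumes "rigid_motion T"
  obtains S where "rigid_motion S" "\<And>x. S (T x) = x"
proof -
  obtain A t where A: "lorentz_matrix A" and T: "T = (\<lambda>x. A *v x + t)"
    using assms by (auto simp: rigid_motion_iff)
  interpret lorentz_matrix A by (fact A)
  define S where "S = (\<lambda>x. matrix_inv A *v x + - (matrix_inv A *v t))"
  have "rigid_motion S"
    unfolding rigid_motion_iff S_def using lorentz_matrix_inv by blast
  moreover have "S (T x) = x" for x
    by (simp add: S_def T matrix_vector_right_distrib inverse_mult)
  ultimately show ?thesis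
    by (rule that)
qed

lemma rigid_motion_matrix_comp:
  assumes "lorentz_matrix R" and "rigid_motion S"
  shows "rigid_motion (\<lambda>x. R *v S x)"
proof -
  obtain A t where A: "lorentz_matrix A" and S: "S = (\<lambda>x. A *v x + t)"
    using assms(2) by (auto simp: rigid_motion_iff)
  have "lorentz_matrix (R ** A)"
    using A assms(1) by (simp add: lorentz_matrix_def matrix_vector_mul_assoc[symmetric])
  moreover have "(\<lambda>x. R *v S x) = (\<lambda>x. (R ** A) *v x + R *v t)"
    by (simp add: S matrix_vector_right_distrib matrix_vector_mul_assoc)
  ultimately show ?thesis
    unfolding rigid_motion_iff by blast
qed

text \<open>The causal character of a line does not depend on the chosen direction vector, so an
  axis cannot belong to two of the canonical types.\<close>

lemma lor_direction:
  assumes "rigid_motion \<Phi>" and "line_with_direction (\<Phi> ` span {e}) d"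
  obtains k where "k \<noteq> 0" "lor d d = k\<^sup>2 * lor e e"
proof -
  obtain A t where A: "lorentz_matrix A" and \<Phi>: "\<Phi> = (\<lambda>x. A *v x + t)"
    using assms(1) by (auto simp: rigid_motion_iff)
  obtain p where d: "d \<noteq> 0" and p: "\<Phi> ` span {e} = range (\<lambda>s. p + s *\<^sub>R d)"
    using assms(2) by (auto simp: line_with_direction_def)
  have "p \<in> range (\<lambda>s. p + s *\<^sub>R d)" "p + d \<in> range (\<lambda>s. p + s *\<^sub>R d)"
    using rangeI[of "\<lambda>s. p + s *\<^sub>R d" 0] rangeI[of "\<lambda>s. p + s *\<^sub>R d" 1] by simp_all
  then have "p \<in> \<Phi> ` span {e}" "p + d \<in> \<Phi> ` span {e}"
    by (simp_all only: p)
  then obtain k1 k2 where "p = A *v (k1 *\<^sub>R e) + t" "p + d = A *v (k2 *\<^sub>R e) + t"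
    by (auto simp: \<Phi> span_singleton)
  then have "d = A *v ((k2 - k1) *\<^sub>R e)"
    by (simp add: scaleR_left_diff_distrib matrix_vector_mult_diff_distrib algebra_simps)
  then have "lor d d = (k2 - k1)\<^sup>2 * lor e e" "k2 \<noteq> k1"
    using A d by (auto simp del: scaleR_left_diff_distrib
        simp: lorentz_matrix_def lor_scale_left lor_scale_right power2_eq_square)
  then show ?thesis
    using that[of "k2 - k1"] by simp
qed

section \<open>Principal curvatures in orthogonal coordinates\<close>

lemma has_vector_derivative_vector3:
  assumes "(f has_real_derivative f') (at x)" "(g has_real_derivative g') (at x)"
    "(h has_real_derivative h') (at x)"
  shows "((\<lambda>s. vector [f s, g s, h s] :: vec3) has_vector_derivative vector [f', g', h']) (at x)"
proof -
  have *: "(vector [i, j, k] :: vec3)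
      = i *\<^sub>R vector [1,0,0] + j *\<^sub>R vector [0,1,0] + k *\<^sub>R vector [0,0,1]" for i j k
    by (simp add: vec3_eq_iff)
  show ?thesis
    unfolding *[of "f _"] *[of f']
    using assms unfolding has_real_derivative_iff_has_vector_derivative
    by (auto intro!: has_vector_derivative_add
        bounded_linear.has_vector_derivative[OF bounded_linear_scaleR_left])
qed

lemma continuous_nonzero_sign:
  fixes f :: "real \<Rightarrow> real"
  assumes "is_interval I" and "continuous_on I f" and "\<And>u. u \<in> I \<Longrightarrow> f u \<noteq> 0"
  obtains s :: real where "s = 1 \<or> s = -1" "\<And>u. u \<in> I \<Longrightarrow> s * f u > 0"
proof -
  have connected: "connected (f ` I)"
    using assms(1,2) by (intro connected_continuous_image is_interval_connected)
  have "\<not> (f u < 0 \<and> f v > 0)" if "u \<in> I" "v \<in> I" for u v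
  proof
    assume "f u < 0 \<and> f v > 0"
    then have "0 \<in> f ` I"
      using connectedD_interval[OF connected, of "f u" "f v" 0] that by simp
    then show False
      using assms(3) by auto
  qed
  then have "(\<forall>u\<in>I. f u > 0) \<or> (\<forall>u\<in>I. f u < 0)"
    using assms(3) by (meson linorder_neqE_linordered_idom)
  then show ?thesis
    using that[of 1] that[of "-1"] by auto
qed

text \<open>\<open>X\<close> is the image under the isometry \<open>x \<mapsto> A x + t\<close> of a surface \<open>Y\<close> about a canonical axis, with
  partial derivatives \<open>Yu\<close> and \<open>Yv\<close>.  The coordinates are orthogonal and, as the rotations are isometries,
  the coefficients \<open>E\<close> and \<open>G\<close> depend on \<open>u\<close> only.  The last assumption reflects that
  $\mathbf{E}_1^3$ contains no negative definite plane.\<close>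

locale rotational_patch = lorentz_matrix A for A :: "real^3^3" +
  fixes I :: "real set" and X Y Yu Yv :: "real \<Rightarrow> real \<Rightarrow> vec3" and t :: vec3
    and E G :: "real \<Rightarrow> real"
  assumes open_I: "open I" and interval_I: "is_interval I"
    and X_eq: "u \<in> I \<Longrightarrow> X u v = A *v Y u v + t"
    and Y_du: "u \<in> I \<Longrightarrow> ((\<lambda>s. Y s v) has_vector_derivative Yu u v) (at u)"
    and Y_dv: "u \<in> I \<Longrightarrow> ((\<lambda>s. Y u s) has_vector_derivative Yv u v) (at v)"
    and E_eq: "u \<in> I \<Longrightarrow> lor (Yu u v) (Yu u v) = E u"
    and F_eq: "u \<in> I \<Longrightarrow> lor (Yu u v) (Yv u v) = 0"
    and G_eq: "u \<in> I \<Longrightarrow> lor (Yv u v) (Yv u v) = G u"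
    and continuous_EG: "continuous_on I E" "continuous_on I G"
    and not_neg_def: "u \<in> I \<Longrightarrow> E u \<ge> 0 \<or> G u \<ge> 0"
begin

lemma linear_A: "bounded_linear ((*v) A)"
  by (simp add: matrix_vector_mul_bounded_linear)

lemma Xu_X: "u \<in> I \<Longrightarrow> Xu X u v = A *v Yu u v"
  unfolding Xu_def
proof (rule vector_derivative_at)
  assume u: "u \<in> I"
  have "((\<lambda>s. A *v Y s v + t) has_vector_derivative A *v Yu u v) (at u)"
    using bounded_linear.has_vector_derivative[OF linear_A Y_du[OF u]]
    by (simp add: has_vector_derivative_add_const)
  then show "((\<lambda>s. X s v) has_vector_derivative A *v Yu u v) (at u)"
    by (rule has_vector_derivative_transform_within_open[OF _ open_I u]) (simp add: X_eq)
qed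

lemma Xv_X: "u \<in> I \<Longrightarrow> Xv X u v = A *v Yv u v"
  unfolding Xv_def
proof (rule vector_derivative_at)
  assume u: "u \<in> I"
  have "X u = (\<lambda>s. A *v Y u s + t)"
    using u by (auto simp: X_eq)
  then show "((\<lambda>s. X u s) has_vector_derivative A *v Yv u v) (at v)"
    using bounded_linear.has_vector_derivative[OF linear_A Y_dv[OF u]]
    by (simp add: has_vector_derivative_add_const)
qed

lemma first_fundamental_form:
  assumes "u \<in> I"
  shows "ffE X u v = E u" "ffF X u v = 0" "ffG X u v = G u"
  using assms by (simp_all add: ffE_def ffF_def ffG_def Xu_X Xv_X lor_preserved E_eq F_eq G_eq)

lemma ind_metric_X:
  "u \<in> I \<Longrightarrow> ind_metric X u v x y = E u * fst x * fst y + G u * snd x * snd y"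
  by (simp add: ind_metric_def first_fundamental_form)

lemma nondegenerate_EG:
  assumes "nondegenerate_surface X (I \<times> UNIV)" and u: "u \<in> I"
  shows "E u \<noteq> 0" "G u \<noteq> 0"
proof -
  have *: "(\<forall>y. ind_metric X u v x y = 0) \<longrightarrow> x = 0" for x v
    using assms unfolding nondegenerate_surface_def by blast
  show "E u \<noteq> 0"
    using *[of _ "(1,0)"] u by (auto simp: ind_metric_X zero_prod_def)
  show "G u \<noteq> 0"
    using *[of _ "(0,1)"] u by (auto simp: ind_metric_X zero_prod_def)
qed

text \<open>On the interval \<open>I\<close> the continuous function \<open>E G\<close> keeps its sign.  So a non-degenerate surface
  is either spacelike or timelike, and \<open>\<epsilon>\<close> is the sign of \<open>E G\<close>.\<close>

lemma causal_sign:
  assumes nondeg: "nondegenerate_surface X (I \<times> UNIV)"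
    and sp: "spacelike_surface X (I \<times> UNIV) \<Longrightarrow> \<epsilon> = 1"
    and ti: "timelike_surface X (I \<times> UNIV) \<Longrightarrow> \<epsilon> = -1"
  shows "\<epsilon> = 1 \<or> \<epsilon> = -1" "u \<in> I \<Longrightarrow> \<epsilon> * (E u * G u) > 0"
proof -
  obtain s where s: "s = 1 \<or> s = -1" "\<And>u. u \<in> I \<Longrightarrow> s * (E u * G u) > 0"
    using nondegenerate_EG[OF nondeg]
    by (rule_tac continuous_nonzero_sign[OF interval_I, of "\<lambda>u. E u * G u"])
       (auto intro!: continuous_intros continuous_EG)
  have "\<epsilon> = s"
  proof (cases "s = 1")
    case True
    then have *: "E u > 0 \<and> G u > 0" if "u \<in> I" for u
      using s(2)[OF that] not_neg_def[OF that] by (auto simp: zero_less_mult_iff)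
    have "0 < E u * (x * x) + G u * (y * y)" if "u \<in> I" "x \<noteq> 0 \<or> y \<noteq> 0" for u x y
      using that
    proof -
      have "0 \<le> E u * (x * x)" "0 \<le> G u * (y * y)"
        using *[OF that(1)] by simp_all
      moreover have "E u * (x * x) \<noteq> 0 \<or> G u * (y * y) \<noteq> 0"
        using *[OF that(1)] that(2) by auto
      ultimately show ?thesis
        by linarith
    qed
    then have "spacelike_surface X (I \<times> UNIV)"
      unfolding spacelike_surface_def by (auto simp: ind_metric_X zero_prod_def mult.assoc)
    then show ?thesis
      using sp True by simp
  next
    case False
    then have s1: "s = -1"
      using s(1) by simp
    have "(\<exists>x. ind_metric X u v x x < 0) \<and> (\<exists>x. ind_metric X u v x x > 0)" if "u \<in> I" for u v
    proof -
      have "ind_metric X u v (1,0) (1,0) = E u" "ind_metric X u v (0,1) (0,1) = G u"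
        using that by (simp_all add: ind_metric_X)
      moreover have "E u < 0 \<and> G u > 0 \<or> E u > 0 \<and> G u < 0"
        using s(2)[OF that] s1 by (auto simp: mult_less_0_iff)
      ultimately show ?thesis
        by metis
    qed
    then have "timelike_surface X (I \<times> UNIV)"
      unfolding timelike_surface_def using nondeg by auto
    then show ?thesis
      using ti s1 by simp
  qed
  then show "\<epsilon> = 1 \<or> \<epsilon> = -1" "u \<in> I \<Longrightarrow> \<epsilon> * (E u * G u) > 0"
    using s by auto
qed

lemma normal_X:
  "u \<in> I \<Longrightarrow> normal \<epsilon> X u v
     = det A *\<^sub>R (A *v ((1 / sqrt (\<epsilon> * (E u * G u))) *\<^sub>R lcross (Yu u v) (Yv u v)))"
  by (simp add: normal_def first_fundamental_form Xu_X Xv_X lcross_matrix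
      matrix_vector_mult_scaleR mult.commute)

text \<open>The hypothesis says that the meridian direction and the parallel direction are principal
  for the unit normal \<open>N\<close> of \<open>Y\<close>, with principal curvatures \<open>k1\<close> and \<open>k2\<close>.  The isometry
  multiplies the normal, hence both curvatures, by its determinant.\<close>

lemma curvatures:
  assumes eps: "\<epsilon> = 1 \<or> \<epsilon> = -1" and u: "u \<in> I" and EG: "E u \<noteq> 0" "G u \<noteq> 0"
    and N: "\<And>u v. u \<in> I \<Longrightarrow> N u v = (1 / sqrt (\<epsilon> * (E u * G u))) *\<^sub>R lcross (Yu u v) (Yv u v)"
    and N_du: "((\<lambda>s. N s v) has_vector_derivative (\<epsilon> * k1) *\<^sub>R Yu u v) (at u)"
    and N_dv: "((\<lambda>s. N u s) has_vector_derivative (\<epsilon> * k2) *\<^sub>R Yv u v) (at v)"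
  shows "mean_curvature \<epsilon> X u v = det A * ((k1 + k2) / 2)"
    and "gauss_curvature \<epsilon> X u v = - \<epsilon> * (k1 * k2)"
proof -
  have normal: "normal \<epsilon> X u v = det A *\<^sub>R (A *v N u v)" if "u \<in> I" for u v
    using normal_X[OF that] N[OF that] by simp
  have bl: "bounded_linear (\<lambda>x. det A *\<^sub>R (A *v x))"
    by (intro bounded_linear_scaleR_right[THEN bounded_linear_compose] linear_A)
  have "((\<lambda>s. det A *\<^sub>R (A *v N s v)) has_vector_derivative
      det A *\<^sub>R (A *v ((\<epsilon> * k1) *\<^sub>R Yu u v))) (at u)"
    by (rule bounded_linear.has_vector_derivative[OF bl N_du])
  then have "((\<lambda>s. normal \<epsilon> X s v) has_vector_derivative
      det A *\<^sub>R (A *v ((\<epsilon> * k1) *\<^sub>R Yu u v))) (at u)"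
    by (rule has_vector_derivative_transform_within_open[OF _ open_I u]) (simp add: normal)
  then have Nu: "Xu (normal \<epsilon> X) u v = (det A * \<epsilon> * k1) *\<^sub>R Xu X u v"
    using u unfolding Xu_def[of "normal \<epsilon> X"]
    by (simp add: vector_derivative_at Xu_X matrix_vector_mult_scaleR mult.assoc)
  have "((\<lambda>s. det A *\<^sub>R (A *v N u s)) has_vector_derivative
      det A *\<^sub>R (A *v ((\<epsilon> * k2) *\<^sub>R Yv u v))) (at v)"
    by (rule bounded_linear.has_vector_derivative[OF bl N_dv])
  moreover have "normal \<epsilon> X u = (\<lambda>s. det A *\<^sub>R (A *v N u s))"
    using u by (auto simp: normal)
  ultimately have Nv: "Xv (normal \<epsilon> X) u v = (det A * \<epsilon> * k2) *\<^sub>R Xv X u v"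
    using u unfolding Xv_def[of "normal \<epsilon> X"]
    by (simp add: vector_derivative_at Xv_X matrix_vector_mult_scaleR mult.assoc)
  have sf: "sfe \<epsilon> X u v = - (det A * \<epsilon> * k1) * E u" "sff \<epsilon> X u v = 0"
      "sfg \<epsilon> X u v = - (det A * \<epsilon> * k2) * G u"
    using first_fundamental_form[OF u]
    by (simp_all add: sfe_def sff_def sfg_def Nu Nv lor_scale_left ffE_def ffF_def ffG_def)
  have eps2: "\<epsilon> * \<epsilon> = 1" and det2: "det A * det A = 1"
    using eps det_squared by (auto simp: power2_eq_square)
  have "mean_curvature \<epsilon> X u v = (\<epsilon> * \<epsilon>) * det A * ((k1 + k2) / 2)"
    using EG by (simp add: mean_curvature_def sf first_fundamental_form[OF u] field_simps)
  then show "mean_curvature \<epsilon> X u v = det A * ((k1 + k2) / 2)"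
    by (simp add: eps2)
  have "gauss_curvature \<epsilon> X u v = - \<epsilon> * (k1 * k2) * (\<epsilon> * \<epsilon>) * (det A * det A)"
    using EG by (simp add: gauss_curvature_def sf first_fundamental_form[OF u] field_simps)
  then show "gauss_curvature \<epsilon> X u v = - \<epsilon> * (k1 * k2)"
    by (simp add: eps2 det2)
qed

end

section \<open>One principal curvature is constant\<close>

lemma constant_of_zero_derivative:
  fixes f :: "real \<Rightarrow> real"
  assumes "is_interval I" and "\<And>u. u \<in> I \<Longrightarrow> (f has_real_derivative 0) (at u)"
  obtains k where "\<And>u. u \<in> I \<Longrightarrow> f u = k"
  using has_field_derivative_zero_constant[of I f] assms is_interval_convex
  by (meson has_field_derivative_at_within)

lemma constant_of_two_values:
  fixes f :: "real \<Rightarrow> real"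
  assumes "is_interval I" and "continuous_on I f" and "\<And>u. u \<in> I \<Longrightarrow> f u = x \<or> f u = y"
  obtains k where "\<And>u. u \<in> I \<Longrightarrow> f u = k"
proof -
  have "f ` I \<subseteq> {x, y}"
    using assms(3) by auto
  then have "finite (f ` I)"
    by (rule finite_subset) simp
  then have "f constant_on I"
    using assms(1,2) is_interval_connected continuous_finite_range_constant by blast
  then show ?thesis
    using that by (auto simp: constant_on_def)
qed

text \<open>Here \<open>\<kappa>1\<close> and \<open>\<kappa>2\<close> are the curvatures along the meridian and the parallel, and \<open>r\<close> is the radius
  function.  The last assumption makes the zeros of \<open>r'\<close> isolated where \<open>\<kappa>1\<close> does not vanish.  It is
  needed about a spacelike axis, where \<open>r = z\<close> may have critical points: there the Weingarten
  relation does not rule out \<open>\<kappa>1 = 0\<close> and \<open>\<kappa>2 = p\<close>, as on a cylinder.\<close>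

lemma constant_meridian_curvature:
  fixes \<kappa>1 \<kappa>2 r r' :: "real \<Rightarrow> real"
  assumes open_I: "open I" and interval_I: "is_interval I"
    and eps: "\<epsilon> = 1 \<or> \<epsilon> = -1" and discr: "a\<^sup>2 - 4 * b * c * \<epsilon> = 0" and ab: "a \<noteq> 0 \<or> b \<noteq> 0"
    and weingarten: "\<And>u. u \<in> I \<Longrightarrow> a * ((\<kappa>1 u + \<kappa>2 u) / 2) + b * (- \<epsilon> * (\<kappa>1 u * \<kappa>2 u)) = c"
    and nonconst: "\<nexists>k. \<forall>u\<in>I. \<kappa>1 u * \<kappa>2 u = k"
    and r_pos: "\<And>u. u \<in> I \<Longrightarrow> r u \<noteq> 0"
    and dr: "\<And>u. u \<in> I \<Longrightarrow> (r has_real_derivative r' u) (at u)"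
    and codazzi: "\<And>u. u \<in> I \<Longrightarrow> ((\<lambda>u. r u * \<kappa>2 u) has_real_derivative r' u * \<kappa>1 u) (at u)"
    and cont: "continuous_on I \<kappa>1"
    and isolated: "\<And>u. \<lbrakk>u \<in> I; r' u = 0; \<kappa>1 u \<noteq> 0\<rbrakk> \<Longrightarrow> \<exists>d. d \<noteq> 0 \<and> (r' has_real_derivative d) (at u)"
  shows "a \<noteq> 0 \<and> b \<noteq> 0 \<and> (\<forall>u\<in>I. \<kappa>1 u = \<epsilon> * a / (2 * b) \<and> \<kappa>2 u \<noteq> \<epsilon> * a / (2 * b))"
proof -
  have eps2: "\<epsilon> * \<epsilon> = 1"
    using eps by auto
  have b: "b \<noteq> 0"
    using ab discr by auto
  have a: "a \<noteq> 0"
  proof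
    assume a: "a = 0"
    then have "c = 0"
      using b discr eps by auto
    then have "\<kappa>1 u * \<kappa>2 u = 0" if "u \<in> I" for u
      using weingarten[OF that] a b eps by auto
    then show False
      using nonconst by blast
  qed
  define p where "p = \<epsilon> * a / (2 * b)"
  have a_eq: "a = 2 * b * \<epsilon> * p"
    using b eps2 by (simp add: p_def)
  have c_eq: "c = b * \<epsilon> * p\<^sup>2"
  proof -
    have "4 * b * \<epsilon> * (c - b * \<epsilon> * p\<^sup>2) = 4 * b * c * \<epsilon> - a\<^sup>2"
      by (simp add: a_eq power2_eq_square algebra_simps)
    also have "\<dots> = 0"
      using discr by simp
    finally have "4 * b * \<epsilon> * (c - b * \<epsilon> * p\<^sup>2) = 0" .
    then have "c - b * \<epsilon> * p\<^sup>2 = 0"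
      using b eps by auto
    then show ?thesis
      by simp
  qed
  have factor: "(\<kappa>1 u - p) * (\<kappa>2 u - p) = 0" if "u \<in> I" for u
  proof -
    have "- b * \<epsilon> * ((\<kappa>1 u - p) * (\<kappa>2 u - p)) = 0"
      using weingarten[OF that] by (simp add: a_eq c_eq power2_eq_square algebra_simps)
    then show ?thesis
      using b eps by auto
  qed
  define y where "y = (\<lambda>u. r u * \<kappa>2 u - p * r u)"
  have y_eq: "y u = r u * (\<kappa>2 u - p)" for u
    by (simp add: y_def algebra_simps)
  have dy: "(y has_real_derivative r' u * (\<kappa>1 u - p)) (at u)" if "u \<in> I" for u
    unfolding y_def
    by (rule DERIV_cong[OF DERIV_diff[OF codazzi[OF that] DERIV_cmult[OF dr[OF that]]]])
       (simp add: algebra_simps)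
  have "((\<lambda>u. (y u)\<^sup>2) has_real_derivative 0) (at u)" if "u \<in> I" for u
  proof -
    have "((\<lambda>u. (y u)\<^sup>2) has_real_derivative 2 * y u * (r' u * (\<kappa>1 u - p))) (at u)"
      by (rule DERIV_cong[OF DERIV_power[OF dy[OF that], of 2]]) simp
    moreover have "2 * y u * (r' u * (\<kappa>1 u - p)) = 2 * r u * r' u * ((\<kappa>1 u - p) * (\<kappa>2 u - p))"
      by (simp add: y_eq)
    ultimately show ?thesis
      by (simp only: factor[OF that] mult_zero_right)
  qed
  then obtain k where k: "\<And>u. u \<in> I \<Longrightarrow> (y u)\<^sup>2 = k"
    using constant_of_zero_derivative[OF interval_I] by metis
  have "k \<noteq> 0"
  proof
    assume "k = 0"
    then have y0: "y u = 0" if "u \<in> I" for u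
      using k[OF that] by simp
    have \<kappa>2: "\<kappa>2 u = p" if "u \<in> I" for u
      using y0[OF that] r_pos[OF that] by (simp add: y_eq)
    have "(y has_real_derivative 0) (at u)" if "u \<in> I" for u
      using DERIV_const[of 0 "at u"]
      by (rule has_field_derivative_transform_within_open[OF _ open_I that]) (simp add: y0)
    then have crit: "r' u * (\<kappa>1 u - p) = 0" if "u \<in> I" for u
      using dy that DERIV_unique by blast
    have "\<kappa>1 u = 0 \<or> \<kappa>1 u = p" if u: "u \<in> I" for u
    proof (cases "r' u = 0 \<and> \<kappa>1 u \<noteq> 0")
      case True
      then obtain d where d: "d \<noteq> 0" "(r' has_real_derivative d) (at u)"
        using isolated u by blast
      \<comment> \<open>The zero of \<open>r'\<close> is isolated, and \<open>\<kappa>1 = p\<close> around it.\<close>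
      have "\<forall>\<^sub>F h in at 0. (r' (u + h) - r' u) / h \<noteq> 0"
        using d(2)[unfolded DERIV_def] d(1) by (rule tendsto_imp_eventually_ne)
      then have "\<forall>\<^sub>F h in at 0. r' (u + h) \<noteq> 0"
        by eventually_elim (use True in auto)
      then have "\<forall>\<^sub>F x in at u. r' x \<noteq> 0"
        by (simp add: eventually_at_to_0[of _ u] add.commute)
      moreover have "\<forall>\<^sub>F x in at u. x \<in> I"
        using open_I u by (rule eventually_at_in_open')
      ultimately have "\<forall>\<^sub>F x in at u. \<kappa>1 x = p"
        by eventually_elim (use crit in auto)
      then have "(\<kappa>1 \<longlongrightarrow> p) (at u)"
        by (rule tendsto_eventually)
      moreover have "(\<kappa>1 \<longlongrightarrow> \<kappa>1 u) (at u)"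
        using cont open_I u continuous_on_eq_continuous_at isCont_def by blast
      ultimately show ?thesis
        using tendsto_unique[OF trivial_limit_at] by blast
    next
      case False
      then show ?thesis
        using crit[OF u] by auto
    qed
    then obtain j where "\<And>u. u \<in> I \<Longrightarrow> \<kappa>1 u = j"
      using constant_of_two_values[OF interval_I cont] by metis
    then show False
      using nonconst \<kappa>2 by auto
  qed
  then have "\<kappa>2 u \<noteq> p" if "u \<in> I" for u
    using k[OF that] by (auto simp: y_eq)
  then show ?thesis
    using a b factor by (auto simp flip: p_def)
qed

text \<open>A non-degenerate linear Weingarten surface on \<open>I \<times> \<real>\<close> with vanishing discriminant and
  non-constant Gauss curvature, where \<open>\<epsilon>\<close> encodes its causal character.\<close>

definition nonconstant_weingarten ::
  "real \<Rightarrow> real \<Rightarrow> real \<Rightarrow> real \<Rightarrow> (real \<Rightarrow> real \<Rightarrow> vec3) \<Rightarrow> real set \<Rightarrow> bool" where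
  "nonconstant_weingarten \<epsilon> a b c X I \<longleftrightarrow>
     nondegenerate_surface X (I \<times> UNIV) \<and>
     (spacelike_surface X (I \<times> UNIV) \<longrightarrow> \<epsilon> = 1) \<and> (timelike_surface X (I \<times> UNIV) \<longrightarrow> \<epsilon> = -1) \<and>
     linear_weingarten \<epsilon> a b c X (I \<times> UNIV) \<and>
     \<not> (\<lambda>(u, v). gauss_curvature \<epsilon> X u v) constant_on (I \<times> UNIV) \<and>
     a\<^sup>2 - 4 * b * c * \<epsilon> = 0"

context rotational_patch
begin

lemma weingarten_causal_sign:
  assumes "nonconstant_weingarten \<epsilon> a b c X I"
  shows "\<epsilon> = 1 \<or> \<epsilon> = -1" "u \<in> I \<Longrightarrow> \<epsilon> * (E u * G u) > 0"
  using causal_sign[of \<epsilon>] assms by (simp_all add: nonconstant_weingarten_def)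

text \<open>The isometry turns the coefficient \<open>a\<close> into \<open>a det A\<close> for the surface \<open>Y\<close>.  As \<open>det A = \<plusminus> 1\<close>,
  this affects the sign of the constant curvature \<open>p\<close> only.\<close>

lemma meridian_curvature:
  fixes \<kappa>1 \<kappa>2 r r' :: "real \<Rightarrow> real"
  assumes W: "nonconstant_weingarten \<epsilon> a b c X I"
    and N: "\<And>u v. u \<in> I \<Longrightarrow> N u v = (1 / sqrt (\<epsilon> * (E u * G u))) *\<^sub>R lcross (Yu u v) (Yv u v)"
    and N_du: "\<And>u v. u \<in> I \<Longrightarrow> ((\<lambda>s. N s v) has_vector_derivative (\<epsilon> * \<kappa>1 u) *\<^sub>R Yu u v) (at u)"
    and N_dv: "\<And>u v. u \<in> I \<Longrightarrow> ((\<lambda>s. N u s) has_vector_derivative (\<epsilon> * \<kappa>2 u) *\<^sub>R Yv u v) (at v)"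
    and r_pos: "\<And>u. u \<in> I \<Longrightarrow> r u \<noteq> 0"
    and dr: "\<And>u. u \<in> I \<Longrightarrow> (r has_real_derivative r' u) (at u)"
    and codazzi: "\<And>u. u \<in> I \<Longrightarrow> ((\<lambda>u. r u * \<kappa>2 u) has_real_derivative r' u * \<kappa>1 u) (at u)"
    and cont: "continuous_on I \<kappa>1"
    and isolated: "\<And>u. \<lbrakk>u \<in> I; r' u = 0; \<kappa>1 u \<noteq> 0\<rbrakk> \<Longrightarrow> \<exists>d. d \<noteq> 0 \<and> (r' has_real_derivative d) (at u)"
  shows "a \<noteq> 0" "b \<noteq> 0"
    and "\<exists>p. p \<noteq> 0 \<and> p\<^sup>2 = a\<^sup>2 / (4 * b\<^sup>2) \<and> (\<forall>u\<in>I. \<kappa>1 u = p \<and> \<kappa>2 u \<noteq> p)"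
proof -
  have nondeg: "nondegenerate_surface X (I \<times> UNIV)"
    and lw: "linear_weingarten \<epsilon> a b c X (I \<times> UNIV)"
    and K: "\<not> (\<lambda>(u, v). gauss_curvature \<epsilon> X u v) constant_on (I \<times> UNIV)"
    and discr: "a\<^sup>2 - 4 * b * c * \<epsilon> = 0"
    using W by (auto simp: nonconstant_weingarten_def)
  note eps = weingarten_causal_sign(1)[OF W]
  have curv: "mean_curvature \<epsilon> X u v = det A * ((\<kappa>1 u + \<kappa>2 u) / 2)"
      "gauss_curvature \<epsilon> X u v = - \<epsilon> * (\<kappa>1 u * \<kappa>2 u)" if "u \<in> I" for u v
    using curvatures[OF eps that nondegenerate_EG[OF nondeg that] N N_du[OF that] N_dv[OF that]]
    by simp_all
  define a' where "a' = det A * a"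
  have a'2: "a'\<^sup>2 = a\<^sup>2"
    by (simp add: a'_def power_mult_distrib det_squared)
  have weingarten: "a' * ((\<kappa>1 u + \<kappa>2 u) / 2) + b * (- \<epsilon> * (\<kappa>1 u * \<kappa>2 u)) = c" if "u \<in> I" for u
  proof -
    have "a * mean_curvature \<epsilon> X u 0 + b * gauss_curvature \<epsilon> X u 0 = c"
      using lw that by (auto simp: linear_weingarten_def)
    then show ?thesis
      using that by (simp add: curv a'_def mult.assoc mult.left_commute)
  qed
  have nonconst: "\<nexists>k. \<forall>u\<in>I. \<kappa>1 u * \<kappa>2 u = k"
  proof
    assume "\<exists>k. \<forall>u\<in>I. \<kappa>1 u * \<kappa>2 u = k"
    then obtain k where "\<forall>u\<in>I. \<kappa>1 u * \<kappa>2 u = k" ..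
    then have "(\<lambda>(u, v). gauss_curvature \<epsilon> X u v) constant_on (I \<times> UNIV)"
      unfolding constant_on_def by (intro exI[of _ "- \<epsilon> * k"]) (auto simp: curv)
    then show False
      using K by simp
  qed
  have ab: "a' \<noteq> 0 \<or> b \<noteq> 0"
    using lw a'2 by (auto simp: linear_weingarten_def)
  have discr': "a'\<^sup>2 - 4 * b * c * \<epsilon> = 0"
    using discr a'2 by simp
  have *: "a' \<noteq> 0 \<and> b \<noteq> 0 \<and>
      (\<forall>u\<in>I. \<kappa>1 u = \<epsilon> * a' / (2 * b) \<and> \<kappa>2 u \<noteq> \<epsilon> * a' / (2 * b))"
    by (rule constant_meridian_curvature[where r = r and r' = r' and c = c])
      (fact open_I interval_I eps discr' ab weingarten nonconst r_pos dr codazzi cont isolated)+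
  show "a \<noteq> 0" "b \<noteq> 0"
    using * by (auto simp: a'_def)
  show "\<exists>p. p \<noteq> 0 \<and> p\<^sup>2 = a\<^sup>2 / (4 * b\<^sup>2) \<and> (\<forall>u\<in>I. \<kappa>1 u = p \<and> \<kappa>2 u \<noteq> p)"
  proof (intro exI[of _ "\<epsilon> * a' / (2 * b)"] conjI)
    show "(\<epsilon> * a' / (2 * b))\<^sup>2 = a\<^sup>2 / (4 * b\<^sup>2)"
      using eps by (auto simp: power_mult_distrib power_divide a'2)
    show "\<epsilon> * a' / (2 * b) \<noteq> 0"
      using eps * by auto
  qed (use * in simp_all)
qed

end

section \<open>Integration of the meridian curve\<close>

lemma profileD:
  assumes "profile I z"
  shows "open I" "is_interval I" "I \<noteq> {}"
    and "\<And>u. u \<in> I \<Longrightarrow> (z has_real_derivative deriv z u) (at u)"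
    and "\<And>u. u \<in> I \<Longrightarrow> (deriv z has_real_derivative deriv (deriv z) u) (at u)"
    and "continuous_on I (deriv (deriv z))"
proof -
  show I: "open I" "is_interval I" "I \<noteq> {}" "continuous_on I (deriv (deriv z))"
    using assms by (simp_all add: profile_def)
  have "(f has_real_derivative deriv f u) (at u)" if "f differentiable_on I" "u \<in> I"
    for f :: "real \<Rightarrow> real" and u
    using that I(1) unfolding DERIV_deriv_iff_real_differentiable
    by (metis at_within_open differentiable_on_def)
  then show "\<And>u. u \<in> I \<Longrightarrow> (z has_real_derivative deriv z u) (at u)"
    "\<And>u. u \<in> I \<Longrightarrow> (deriv z has_real_derivative deriv (deriv z) u) (at u)"
    using assms by (simp_all add: profile_def)
qed

lemma profileI:
  assumes I: "open I" "is_interval I" "I \<noteq> {}"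
    and z: "\<And>u. u \<in> I \<Longrightarrow> (z has_real_derivative z1 u) (at u)"
    and z1: "\<And>u. u \<in> I \<Longrightarrow> (z1 has_real_derivative z2 u) (at u)"
    and z2: "continuous_on I z2"
  shows "profile I z"
proof -
  have dz: "deriv z u = z1 u" if "u \<in> I" for u
    using z[OF that] by (rule DERIV_imp_deriv)
  have dz1: "(deriv z has_real_derivative z2 u) (at u)" if "u \<in> I" for u
    using z1[OF that] by (rule has_field_derivative_transform_within_open[OF _ I(1) that]) (simp add: dz)
  have "continuous_on I (deriv (deriv z))"
    using z2 by (rule continuous_on_eq) (simp add: DERIV_imp_deriv[OF dz1])
  then show ?thesis
    using I z dz1 unfolding profile_def differentiable_on_def
    by (meson has_field_derivative_at_within real_differentiable_def)
qed

text \<open>For \<open>w = z'\<close> and suitable signs \<open>\<alpha>\<close> and \<open>\<beta>\<close>, the function \<open>P\<close> is the Lorentzian speed of the graph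
  of \<open>z\<close>, and \<open>w / P\<close> and \<open>1 / P\<close> are, up to sign, the components of its unit normal.\<close>

lemma unit_speed_derivatives:
  fixes w :: "real \<Rightarrow> real"
  assumes w: "(w has_real_derivative w') (at u)" and pos: "\<alpha> + \<beta> * (w u)\<^sup>2 > 0"
    and P: "P = (\<lambda>u. sqrt (\<alpha> + \<beta> * (w u)\<^sup>2))"
  shows "((\<lambda>u. w u / P u) has_real_derivative \<alpha> * w' / P u ^ 3) (at u)"
    and "((\<lambda>u. 1 / P u) has_real_derivative - \<beta> * w u * w' / P u ^ 3) (at u)"
proof -
  have P_pos: "P u > 0" and P2: "P u * P u = \<alpha> + \<beta> * (w u)\<^sup>2"
    using pos by (simp_all add: P)
  have dP: "(P has_real_derivative \<beta> * w u * w' / P u) (at u)"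
    unfolding P using pos by (auto intro!: derivative_eq_intros w simp: field_simps)
  have "(w' * P u - w u * (\<beta> * w u * w' / P u)) / (P u * P u) = \<alpha> * w' / P u ^ 3"
  proof -
    have "w' * P u - w u * (\<beta> * w u * w' / P u) = w' * (P u * P u - \<beta> * (w u)\<^sup>2) / P u"
      using P_pos by (simp add: field_simps power2_eq_square)
    then show ?thesis
      using P_pos by (simp add: P2 power3_eq_cube mult.commute mult.left_commute)
  qed
  then show "((\<lambda>u. w u / P u) has_real_derivative \<alpha> * w' / P u ^ 3) (at u)"
    using DERIV_divide[OF w dP] P_pos by simp
  show "((\<lambda>u. 1 / P u) has_real_derivative - \<beta> * w u * w' / P u ^ 3) (at u)"
    using P_pos by (auto intro!: derivative_eq_intros dP simp: field_simps power3_eq_cube)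
qed

lemma affine_of_constant_derivative:
  fixes f g :: "real \<Rightarrow> real"
  assumes I: "is_interval I"
    and f: "\<And>u. u \<in> I \<Longrightarrow> (f has_real_derivative k * g' u) (at u)"
    and g: "\<And>u. u \<in> I \<Longrightarrow> (g has_real_derivative g' u) (at u)" and k: "k \<noteq> 0"
  shows "\<exists>x0. \<forall>u\<in>I. f u = k * (g u - x0)"
proof -
  have "((\<lambda>u. f u - k * g u) has_real_derivative 0) (at u)" if "u \<in> I" for u
    by (rule DERIV_cong[OF DERIV_diff[OF f[OF that] DERIV_cmult[OF g[OF that]]]]) simp
  then obtain m where m: "\<And>u. u \<in> I \<Longrightarrow> f u - k * g u = m"
    using constant_of_zero_derivative[OF I, of "\<lambda>u. f u - k * g u"] by blast
  then have "f u = k * (g u - - m / k)" if "u \<in> I" for u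
    using m[OF that] k by (simp add: field_simps)
  then show ?thesis
    by blast
qed

text \<open>The equation \<open>z'' = k P\<^sup>3\<close> makes \<open>z' / P\<close> an affine function of \<open>u\<close> and \<open>1 / P\<close> an affine
  function of \<open>z\<close>.  The identity \<open>\<alpha> (1 / P)\<^sup>2 + \<beta> (z' / P)\<^sup>2 = 1\<close> is then the equation of a conic.\<close>

lemma constant_curvature_arc:
  fixes z z1 z2 P :: "real \<Rightarrow> real"
  assumes I: "is_interval I"
    and \<alpha>: "\<alpha> = 1 \<or> \<alpha> = -1" and \<beta>: "\<beta> = 1 \<or> \<beta> = -1" and k: "k \<noteq> 0"
    and z: "\<And>u. u \<in> I \<Longrightarrow> (z has_real_derivative z1 u) (at u)"
    and z1: "\<And>u. u \<in> I \<Longrightarrow> (z1 has_real_derivative z2 u) (at u)"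
    and pos: "\<And>u. u \<in> I \<Longrightarrow> \<alpha> + \<beta> * (z1 u)\<^sup>2 > 0"
    and P: "P = (\<lambda>u. sqrt (\<alpha> + \<beta> * (z1 u)\<^sup>2))"
    and curvature: "\<And>u. u \<in> I \<Longrightarrow> z2 u / P u ^ 3 = k"
  shows "\<exists>u0 z0 \<sigma>. (\<sigma> = 1 \<or> \<sigma> = -1) \<and>
    (\<forall>u\<in>I. \<alpha> / k\<^sup>2 - \<alpha> * \<beta> * (u - u0)\<^sup>2 \<ge> 0 \<and>
       z u = z0 + \<sigma> * sqrt (\<alpha> / k\<^sup>2 - \<alpha> * \<beta> * (u - u0)\<^sup>2))"
proof -
  have ak: "\<alpha> * k \<noteq> 0" and bk: "- \<beta> * k \<noteq> 0"
    using \<alpha> \<beta> k by auto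
  have "((\<lambda>u. z1 u / P u) has_real_derivative (\<alpha> * k) * 1) (at u)" if "u \<in> I" for u
    using unit_speed_derivatives(1)[OF z1[OF that] pos[OF that] P]
    by (simp add: curvature[OF that, symmetric])
  then have "\<exists>u0. \<forall>u\<in>I. z1 u / P u = \<alpha> * k * (u - u0)"
    by (rule affine_of_constant_derivative[OF I _ DERIV_ident ak])
  then obtain u0 where u0: "\<And>u. u \<in> I \<Longrightarrow> z1 u / P u = \<alpha> * k * (u - u0)"
    by blast
  have "((\<lambda>u. 1 / P u) has_real_derivative (- \<beta> * k) * z1 u) (at u)" if "u \<in> I" for u
    using unit_speed_derivatives(2)[OF z1[OF that] pos[OF that] P]
    by (simp add: curvature[OF that, symmetric] mult_ac)
  then have "\<exists>z0. \<forall>u\<in>I. 1 / P u = - \<beta> * k * (z u - z0)"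
    by (rule affine_of_constant_derivative[OF I _ z bk])
  then obtain z0 where z0: "\<And>u. u \<in> I \<Longrightarrow> 1 / P u = - \<beta> * k * (z u - z0)"
    by blast
  define \<sigma> where "\<sigma> = sgn (- \<beta> * k)"
  have \<sigma>: "\<sigma> = 1 \<or> \<sigma> = -1"
    using \<beta> k by (auto simp: \<sigma>_def sgn_if)
  have arc: "\<alpha> / k\<^sup>2 - \<alpha> * \<beta> * (u - u0)\<^sup>2 = (z u - z0)\<^sup>2" if u: "u \<in> I" for u
  proof -
    have P_pos: "P u > 0" and P2: "(P u)\<^sup>2 = \<alpha> + \<beta> * (z1 u)\<^sup>2"
      using pos[OF u] by (simp_all add: P)
    have "\<alpha> * (1 / P u)\<^sup>2 + \<beta> * (z1 u / P u)\<^sup>2 = 1"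
    proof -
      have "\<alpha> * (1 / P u)\<^sup>2 + \<beta> * (z1 u / P u)\<^sup>2 = (\<alpha> + \<beta> * (z1 u)\<^sup>2) / (P u)\<^sup>2"
        by (simp add: power_divide add_divide_distrib)
      then show ?thesis
        using P_pos by (simp flip: P2)
    qed
    then have "\<alpha> * (k * (z u - z0))\<^sup>2 + \<beta> * (k * (u - u0))\<^sup>2 = 1"
      using \<alpha> \<beta> by (auto simp: u0[OF u] z0[OF u] power_mult_distrib)
    then have "k\<^sup>2 * (z u - z0)\<^sup>2 = \<alpha> - \<alpha> * \<beta> * k\<^sup>2 * (u - u0)\<^sup>2"
      using \<alpha> by (auto simp: power_mult_distrib)
    then show ?thesis
      using k by (simp add: field_simps)
  qed
  \<comment> \<open>Since \<open>1 / P > 0\<close>, the curve stays on one branch of the conic.\<close>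
  have "z u - z0 = \<sigma> * \<bar>z u - z0\<bar>" if u: "u \<in> I" for u
  proof -
    have "- \<beta> * k * (z u - z0) > 0"
      unfolding z0[OF u, symmetric] using pos[OF u] by (simp add: P)
    then have "sgn (- \<beta> * k) * sgn (z u - z0) = 1"
      by (simp only: sgn_mult[symmetric] sgn_pos)
    then show ?thesis
      using \<sigma> unfolding \<sigma>_def[symmetric] by (auto simp: sgn_if split: if_splits)
  qed
  then have zu: "z u = z0 + \<sigma> * sqrt ((z u - z0)\<^sup>2)" if "u \<in> I" for u
    using that by (simp add: algebra_simps)
  show ?thesis
    by (rule exI[of _ u0], rule exI[of _ z0], rule exI[of _ \<sigma>]) (use \<sigma> arc zu in simp)
qed

section \<open>Meridians about the canonical axes\<close>

text \<open>In each of the following three lemmas \<open>N\<close> is the unit normal of the surface about the canonical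
  axis, and \<open>s\<close> is the sign of the radius function.\<close>

lemma timelike_axis_meridian:
  assumes A: "lorentz_matrix A" and z: "profile I z"
    and X: "\<And>u v. u \<in> I \<Longrightarrow> X u v = A *v (rot_timelike v *v vector [u, 0, z u]) + t"
    and W: "nonconstant_weingarten \<epsilon> a b c X I"
  shows "a \<noteq> 0 \<and> b \<noteq> 0 \<and> (\<epsilon> = 1 \<or> \<epsilon> = -1) \<and>
    (\<exists>u0 z0 \<sigma>. (\<sigma> = 1 \<or> \<sigma> = -1) \<and>
      (\<forall>u\<in>I. 4 * \<epsilon> * b\<^sup>2 / a\<^sup>2 + (u - u0)\<^sup>2 \<ge> 0 \<and>
        z u = z0 + \<sigma> * sqrt (4 * \<epsilon> * b\<^sup>2 / a\<^sup>2 + (u - u0)\<^sup>2)))"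
proof -
  note I = profileD(1-3)[OF z]
  define z1 z2 where "z1 = deriv z" and "z2 = deriv (deriv z)"
  have dz: "(z has_real_derivative z1 u) (at u)" and dz1: "(z1 has_real_derivative z2 u) (at u)"
    if "u \<in> I" for u
    using profileD(4,5)[OF z that] by (simp_all add: z1_def z2_def)
  have cont_z2: "continuous_on I z2"
    using profileD(6)[OF z] by (simp add: z2_def)
  have cont_z1: "continuous_on I z1"
    using dz1 by (meson DERIV_continuous_on has_field_derivative_at_within)
  define Y :: "real \<Rightarrow> real \<Rightarrow> vec3" where "Y = (\<lambda>u v. vector [u * cos v, - u * sin v, z u])"
  define Yu :: "real \<Rightarrow> real \<Rightarrow> vec3" where "Yu = (\<lambda>u v. vector [cos v, - sin v, z1 u])"
  define Yv :: "real \<Rightarrow> real \<Rightarrow> vec3" where "Yv = (\<lambda>u v. vector [- u * sin v, - u * cos v, 0])"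
  define E where "E = (\<lambda>u. 1 - (z1 u)\<^sup>2)"
  define G :: "real \<Rightarrow> real" where "G = (\<lambda>u. u\<^sup>2)"
  interpret lorentz_matrix A by (fact A)
  interpret rotational_patch A I X Y Yu Yv t E G
  proof
    fix u v assume u: "u \<in> I"
    have "rot_timelike v *v vector [u, 0, z u] = Y u v"
      by (simp add: rot_timelike_def Y_def vec_eq_iff forall_3 matrix_vector_mult_def sum_3)
    then show "X u v = A *v Y u v + t"
      using X[OF u] by simp
    show "((\<lambda>s. Y s v) has_vector_derivative Yu u v) (at u)"
      unfolding Y_def Yu_def
      by (rule has_vector_derivative_vector3) (auto intro!: derivative_eq_intros dz u)
    show "((\<lambda>s. Y u s) has_vector_derivative Yv u v) (at v)"
      unfolding Y_def Yv_def
      by (rule has_vector_derivative_vector3) (auto intro!: derivative_eq_intros)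
    have sc: "cos v * cos v = 1 - sin v * sin v"
      using sin_cos_squared_add3[of v] by linarith
    show "lor (Yu u v) (Yu u v) = E u" "lor (Yu u v) (Yv u v) = 0" "lor (Yv u v) (Yv u v) = G u"
      by (simp_all add: lor_def Yu_def Yv_def E_def G_def power2_eq_square algebra_simps sc)
    show "E u \<ge> 0 \<or> G u \<ge> 0"
      by (simp add: G_def)
  next
    show "continuous_on I E" "continuous_on I G"
      unfolding E_def G_def by (intro continuous_intros cont_z1)+
  qed (fact I(1,2))+
  note eps = weingarten_causal_sign(1)[OF W] and EG = weingarten_causal_sign(2)[OF W]
  have r0: "u \<noteq> 0" if "u \<in> I" for u
    using EG[OF that] by (auto simp: G_def)
  have pos: "\<epsilon> + - \<epsilon> * (z1 u)\<^sup>2 > 0" if "u \<in> I" for u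
  proof -
    have "\<epsilon> * (E u * G u) = (\<epsilon> + - \<epsilon> * (z1 u)\<^sup>2) * u\<^sup>2"
      by (simp add: E_def G_def algebra_simps)
    then show ?thesis
      using EG[OF that] by (simp only: zero_less_mult_iff) (auto dest: power2_less_0[THEN notE])
  qed
  define P where "P = (\<lambda>u. sqrt (\<epsilon> + - \<epsilon> * (z1 u)\<^sup>2))"
  have P_pos: "P u > 0" if "u \<in> I" for u
    using pos[OF that] by (simp add: P_def)
  obtain s :: real where s: "s = 1 \<or> s = -1" "\<And>u. u \<in> I \<Longrightarrow> s * u > 0"
    using continuous_nonzero_sign[OF I(2) continuous_on_id r0] by auto
  define N :: "real \<Rightarrow> real \<Rightarrow> vec3" where
    "N = (\<lambda>u v. vector [s * (z1 u / P u) * cos v, - (s * (z1 u / P u) * sin v), s * (1 / P u)])"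
  define \<kappa>1 where "\<kappa>1 = (\<lambda>u. s * z2 u / P u ^ 3)"
  define \<kappa>2 where "\<kappa>2 = (\<lambda>u. \<epsilon> * s * (z1 u / P u) / u)"
  note dq = unit_speed_derivatives[OF dz1 pos P_def]
  have N_eq: "N u v = (1 / sqrt (\<epsilon> * (E u * G u))) *\<^sub>R lcross (Yu u v) (Yv u v)" if "u \<in> I" for u v
  proof -
    have "\<epsilon> * (E u * G u) = (\<epsilon> + - \<epsilon> * (z1 u)\<^sup>2) * (s * u)\<^sup>2"
      using s(1) by (auto simp: E_def G_def algebra_simps)
    then have sq: "sqrt (\<epsilon> * (E u * G u)) = P u * (s * u)"
      using s(2)[OF that] by (simp add: real_sqrt_mult P_def)
    have sc: "sin v * sin v + cos v * cos v = 1"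
      using sin_cos_squared_add3[of v] by linarith
    have "lcross (Yu u v) (Yv u v) = vector [z1 u * u * cos v, - (z1 u * u * sin v), u]"
      by (simp add: sc lcross_def Yu_def Yv_def vec3_eq_iff mult.commute mult.left_commute
          flip: distrib_left)
    then show ?thesis
      unfolding sq using s(1) P_pos[OF that] r0[OF that] by (auto simp: N_def vec3_eq_iff)
  qed
  have N_du: "((\<lambda>w. N w v) has_vector_derivative (\<epsilon> * \<kappa>1 u) *\<^sub>R Yu u v) (at u)" if "u \<in> I" for u v
  proof -
    have "((\<lambda>w. N w v) has_vector_derivative
        vector [s * (\<epsilon> * z2 u / P u ^ 3) * cos v, - (s * (\<epsilon> * z2 u / P u ^ 3) * sin v),
          s * (- (- \<epsilon>) * z1 u * z2 u / P u ^ 3)]) (at u)"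
      unfolding N_def
      by (intro has_vector_derivative_vector3 DERIV_minus DERIV_cmult_right DERIV_cmult dq that)
    moreover have "vector [s * (\<epsilon> * z2 u / P u ^ 3) * cos v, - (s * (\<epsilon> * z2 u / P u ^ 3) * sin v),
          s * (- (- \<epsilon>) * z1 u * z2 u / P u ^ 3)] = (\<epsilon> * \<kappa>1 u) *\<^sub>R Yu u v"
      by (simp add: vec3_eq_iff \<kappa>1_def Yu_def)
    ultimately show ?thesis
      by simp
  qed
  have N_dv: "((\<lambda>w. N u w) has_vector_derivative (\<epsilon> * \<kappa>2 u) *\<^sub>R Yv u v) (at v)" if "u \<in> I" for u v
  proof -
    have "((\<lambda>w. N u w) has_vector_derivative
        vector [s * (z1 u / P u) * - sin v, - (s * (z1 u / P u) * cos v), 0]) (at v)"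
      unfolding N_def
      by (intro has_vector_derivative_vector3 DERIV_minus DERIV_cmult DERIV_const DERIV_cos DERIV_sin)
    moreover have "vector [s * (z1 u / P u) * - sin v, - (s * (z1 u / P u) * cos v), 0]
        = (\<epsilon> * \<kappa>2 u) *\<^sub>R Yv u v"
      using eps r0[OF that] by (auto simp: vec3_eq_iff \<kappa>2_def Yv_def)
    ultimately show ?thesis
      by simp
  qed
  have codazzi: "((\<lambda>w. w * \<kappa>2 w) has_real_derivative 1 * \<kappa>1 u) (at u)" if "u \<in> I" for u
  proof -
    have "((\<lambda>w. \<epsilon> * s * (z1 w / P w)) has_real_derivative \<epsilon> * s * (\<epsilon> * z2 u / P u ^ 3)) (at u)"
      by (intro DERIV_cmult dq that)
    then have "((\<lambda>w. w * \<kappa>2 w) has_real_derivative \<epsilon> * s * (\<epsilon> * z2 u / P u ^ 3)) (at u)"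
      by (rule has_field_derivative_transform_within_open[OF _ I(1) that]) (simp add: \<kappa>2_def r0)
    moreover have "\<epsilon> * s * (\<epsilon> * z2 u / P u ^ 3) = 1 * \<kappa>1 u"
      using eps by (auto simp: \<kappa>1_def)
    ultimately show ?thesis
      by simp
  qed
  have cont: "continuous_on I \<kappa>1"
    unfolding \<kappa>1_def P_def
    by (intro continuous_intros cont_z1 cont_z2) (use pos in fastforce)
  have ab: "a \<noteq> 0" "b \<noteq> 0"
    and "\<exists>p. p \<noteq> 0 \<and> p\<^sup>2 = a\<^sup>2 / (4 * b\<^sup>2) \<and> (\<forall>u\<in>I. \<kappa>1 u = p \<and> \<kappa>2 u \<noteq> p)"
    by (rule meridian_curvature[OF W N_eq N_du N_dv r0 DERIV_ident codazzi cont]; simp)+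
  then obtain p where p: "p \<noteq> 0" "p\<^sup>2 = a\<^sup>2 / (4 * b\<^sup>2)" "\<And>u. u \<in> I \<Longrightarrow> \<kappa>1 u = p"
    by blast
  have k: "s * p \<noteq> 0" and k2: "(s * p)\<^sup>2 = a\<^sup>2 / (4 * b\<^sup>2)"
    using p s(1) by (auto simp: power_mult_distrib)
  have curv: "z2 u / P u ^ 3 = s * p" if "u \<in> I" for u
    using p(3)[OF that] s(1) by (auto simp: \<kappa>1_def)
  have eps': "- \<epsilon> = 1 \<or> - \<epsilon> = -1"
    using eps by auto
  have radius: "\<epsilon> / (s * p)\<^sup>2 - \<epsilon> * - \<epsilon> * x = 4 * \<epsilon> * b\<^sup>2 / a\<^sup>2 + x" for x
    using eps k2 by auto
  have "\<exists>u0 z0 \<sigma>. (\<sigma> = 1 \<or> \<sigma> = -1) \<and>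
      (\<forall>u\<in>I. \<epsilon> / (s * p)\<^sup>2 - \<epsilon> * - \<epsilon> * (u - u0)\<^sup>2 \<ge> 0 \<and>
         z u = z0 + \<sigma> * sqrt (\<epsilon> / (s * p)\<^sup>2 - \<epsilon> * - \<epsilon> * (u - u0)\<^sup>2))"
    by (rule constant_curvature_arc[OF I(2) eps eps' k dz dz1 pos P_def curv])
  then show ?thesis
    unfolding radius using ab eps by blast
qed

text \<open>The two kinds of meridian about a spacelike axis are treated together: \<open>(f, g) = (sinh, cosh)\<close>
  with \<open>\<eta> = -1\<close>, and \<open>(f, g) = (cosh, sinh)\<close> with \<open>\<eta> = 1\<close>.  In the second case the induced metric has
  \<open>E > 0\<close> and \<open>G < 0\<close>, which forces \<open>\<epsilon> = -1\<close>.\<close>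

lemma spacelike_axis_meridian:
  fixes f g :: "real \<Rightarrow> real"
  assumes A: "lorentz_matrix A" and z: "profile I z"
    and X: "\<And>u v. u \<in> I \<Longrightarrow> X u v = A *v vector [u, z u * f v, z u * g v] + t"
    and df: "\<And>v. (f has_real_derivative g v) (at v)"
    and dg: "\<And>v. (g has_real_derivative f v) (at v)"
    and fg: "\<And>v. f v * f v - g v * g v = \<eta>" and \<eta>: "\<eta> = 1 \<or> \<eta> = -1"
    and W: "nonconstant_weingarten \<epsilon> a b c X I"
  shows "a \<noteq> 0 \<and> b \<noteq> 0 \<and> (\<epsilon> = 1 \<or> \<epsilon> = -1) \<and> (\<eta> = 1 \<longrightarrow> \<epsilon> = -1) \<and>
    (\<exists>u0 z0 \<sigma>. (\<sigma> = 1 \<or> \<sigma> = -1) \<and>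
      (\<forall>u\<in>I. - \<epsilon> * \<eta> * (4 * b\<^sup>2 / a\<^sup>2) - \<eta> * (u - u0)\<^sup>2 \<ge> 0 \<and>
        z u = z0 + \<sigma> * sqrt (- \<epsilon> * \<eta> * (4 * b\<^sup>2 / a\<^sup>2) - \<eta> * (u - u0)\<^sup>2)))"
proof -
  note I = profileD(1-3)[OF z]
  define z1 z2 where "z1 = deriv z" and "z2 = deriv (deriv z)"
  have dz: "(z has_real_derivative z1 u) (at u)" and dz1: "(z1 has_real_derivative z2 u) (at u)"
    if "u \<in> I" for u
    using profileD(4,5)[OF z that] by (simp_all add: z1_def z2_def)
  have cont_z2: "continuous_on I z2"
    using profileD(6)[OF z] by (simp add: z2_def)
  have cont_z1: "continuous_on I z1" and cont_z: "continuous_on I z"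
    using dz dz1 by (meson DERIV_continuous_on has_field_derivative_at_within)+
  define Y :: "real \<Rightarrow> real \<Rightarrow> vec3" where "Y = (\<lambda>u v. vector [u, z u * f v, z u * g v])"
  define Yu :: "real \<Rightarrow> real \<Rightarrow> vec3" where "Yu = (\<lambda>u v. vector [1, z1 u * f v, z1 u * g v])"
  define Yv :: "real \<Rightarrow> real \<Rightarrow> vec3" where "Yv = (\<lambda>u v. vector [0, z u * g v, z u * f v])"
  define E where "E = (\<lambda>u. 1 + \<eta> * (z1 u)\<^sup>2)"
  define G where "G = (\<lambda>u. - \<eta> * (z u)\<^sup>2)"
  interpret lorentz_matrix A by (fact A)
  interpret rotational_patch A I X Y Yu Yv t E G
  proof
    fix u v assume u: "u \<in> I"
    show "X u v = A *v Y u v + t"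
      using X[OF u] by (simp add: Y_def)
    show "((\<lambda>s. Y s v) has_vector_derivative Yu u v) (at u)"
      unfolding Y_def Yu_def
      by (intro has_vector_derivative_vector3 DERIV_cmult_right dz u DERIV_ident)
    show "((\<lambda>s. Y u s) has_vector_derivative Yv u v) (at v)"
      unfolding Y_def Yv_def
      by (intro has_vector_derivative_vector3 DERIV_cmult df dg DERIV_const)
    show "lor (Yu u v) (Yu u v) = E u" "lor (Yu u v) (Yv u v) = 0" "lor (Yv u v) (Yv u v) = G u"
      by (simp_all add: lor_def Yu_def Yv_def E_def G_def power2_eq_square algebra_simps
          flip: fg[of v])
    show "E u \<ge> 0 \<or> G u \<ge> 0"
      using \<eta> by (auto simp: E_def G_def)
  next
    show "continuous_on I E" "continuous_on I G"
      unfolding E_def G_def by (intro continuous_intros cont_z1 cont_z)+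
  qed (fact I(1,2))+
  note eps = weingarten_causal_sign(1)[OF W] and EG = weingarten_causal_sign(2)[OF W]
  have EG_eq: "\<epsilon> * (E u * G u) = (- \<epsilon> * \<eta> + - \<epsilon> * (z1 u)\<^sup>2) * (z u)\<^sup>2" for u
    using \<eta> by (auto simp: E_def G_def algebra_simps)
  have r0: "z u \<noteq> 0" if "u \<in> I" for u
    using EG[OF that] by (auto simp: G_def)
  have pos: "- \<epsilon> * \<eta> + - \<epsilon> * (z1 u)\<^sup>2 > 0" if "u \<in> I" for u
    using EG[OF that] unfolding EG_eq zero_less_mult_iff by (auto dest: power2_less_0[THEN notE])
  define P where "P = (\<lambda>u. sqrt (- \<epsilon> * \<eta> + - \<epsilon> * (z1 u)\<^sup>2))"
  have P_pos: "P u > 0" if "u \<in> I" for u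
    using pos[OF that] by (simp add: P_def)
  obtain s :: real where s: "s = 1 \<or> s = -1" "\<And>u. u \<in> I \<Longrightarrow> s * z u > 0"
    using continuous_nonzero_sign[OF I(2) cont_z r0] by auto
  define N :: "real \<Rightarrow> real \<Rightarrow> vec3" where
    "N = (\<lambda>u v. vector [s * \<eta> * (z1 u / P u), - s * (1 / P u) * f v, - s * (1 / P u) * g v])"
  define \<kappa>1 where "\<kappa>1 = (\<lambda>u. - s * z2 u / P u ^ 3)"
  define \<kappa>2 where "\<kappa>2 = (\<lambda>u. - \<epsilon> * s * (1 / P u) / z u)"
  note dq = unit_speed_derivatives[OF dz1 pos P_def]
  have N_eq: "N u v = (1 / sqrt (\<epsilon> * (E u * G u))) *\<^sub>R lcross (Yu u v) (Yv u v)" if "u \<in> I" for u v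
  proof -
    have "\<epsilon> * (E u * G u) = (- \<epsilon> * \<eta> + - \<epsilon> * (z1 u)\<^sup>2) * (s * z u)\<^sup>2"
      unfolding EG_eq using s(1) by auto
    then have sq: "sqrt (\<epsilon> * (E u * G u)) = P u * (s * z u)"
      using s(2)[OF that] by (simp add: real_sqrt_mult P_def)
    have "lcross (Yu u v) (Yv u v) = vector [\<eta> * z1 u * z u, - (z u * f v), - (z u * g v)]"
      by (simp add: lcross_def Yu_def Yv_def vec3_eq_iff algebra_simps flip: fg[of v])
    then show ?thesis
      unfolding sq using s(1) P_pos[OF that] r0[OF that] by (auto simp: N_def vec3_eq_iff)
  qed
  have N_du: "((\<lambda>w. N w v) has_vector_derivative (\<epsilon> * \<kappa>1 u) *\<^sub>R Yu u v) (at u)" if "u \<in> I" for u v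
  proof -
    have "((\<lambda>w. N w v) has_vector_derivative
        vector [s * \<eta> * (- \<epsilon> * \<eta> * z2 u / P u ^ 3),
          - s * (- (- \<epsilon>) * z1 u * z2 u / P u ^ 3) * f v,
          - s * (- (- \<epsilon>) * z1 u * z2 u / P u ^ 3) * g v]) (at u)"
      unfolding N_def
      by (intro has_vector_derivative_vector3 DERIV_cmult_right DERIV_cmult dq that)
    moreover have "vector [s * \<eta> * (- \<epsilon> * \<eta> * z2 u / P u ^ 3),
          - s * (- (- \<epsilon>) * z1 u * z2 u / P u ^ 3) * f v,
          - s * (- (- \<epsilon>) * z1 u * z2 u / P u ^ 3) * g v] = (\<epsilon> * \<kappa>1 u) *\<^sub>R Yu u v"
      using \<eta> by (auto simp: vec3_eq_iff \<kappa>1_def Yu_def)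
    ultimately show ?thesis
      by simp
  qed
  have N_dv: "((\<lambda>w. N u w) has_vector_derivative (\<epsilon> * \<kappa>2 u) *\<^sub>R Yv u v) (at v)" if "u \<in> I" for u v
  proof -
    have "((\<lambda>w. N u w) has_vector_derivative
        vector [0, - s * (1 / P u) * g v, - s * (1 / P u) * f v]) (at v)"
      unfolding N_def
      by (intro has_vector_derivative_vector3 DERIV_cmult DERIV_const df dg)
    moreover have "vector [0, - s * (1 / P u) * g v, - s * (1 / P u) * f v]
        = (\<epsilon> * \<kappa>2 u) *\<^sub>R Yv u v"
      using eps r0[OF that] by (auto simp: vec3_eq_iff \<kappa>2_def Yv_def)
    ultimately show ?thesis
      by simp
  qed
  have codazzi: "((\<lambda>w. z w * \<kappa>2 w) has_real_derivative z1 u * \<kappa>1 u) (at u)" if "u \<in> I" for u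
  proof -
    have "((\<lambda>w. - \<epsilon> * s * (1 / P w)) has_real_derivative
        - \<epsilon> * s * (- (- \<epsilon>) * z1 u * z2 u / P u ^ 3)) (at u)"
      by (intro DERIV_cmult dq that)
    then have "((\<lambda>w. z w * \<kappa>2 w) has_real_derivative
        - \<epsilon> * s * (- (- \<epsilon>) * z1 u * z2 u / P u ^ 3)) (at u)"
      by (rule has_field_derivative_transform_within_open[OF _ I(1) that]) (simp add: \<kappa>2_def r0)
    moreover have "- \<epsilon> * s * (- (- \<epsilon>) * z1 u * z2 u / P u ^ 3) = z1 u * \<kappa>1 u"
      using eps by (auto simp: \<kappa>1_def)
    ultimately show ?thesis
      by simp
  qed
  have cont: "continuous_on I \<kappa>1"
    unfolding \<kappa>1_def P_def
    by (intro continuous_intros cont_z1 cont_z2) (use pos in fastforce)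
  have isolated: "\<exists>d. d \<noteq> 0 \<and> (z1 has_real_derivative d) (at u)"
    if "u \<in> I" "z1 u = 0" "\<kappa>1 u \<noteq> 0" for u
    using dz1[OF that(1)] that(3) by (auto simp: \<kappa>1_def)
  have ab: "a \<noteq> 0" "b \<noteq> 0"
    and "\<exists>p. p \<noteq> 0 \<and> p\<^sup>2 = a\<^sup>2 / (4 * b\<^sup>2) \<and> (\<forall>u\<in>I. \<kappa>1 u = p \<and> \<kappa>2 u \<noteq> p)"
    by (rule meridian_curvature[OF W N_eq N_du N_dv r0 dz codazzi cont isolated]; simp)+
  then obtain p where p: "p \<noteq> 0" "p\<^sup>2 = a\<^sup>2 / (4 * b\<^sup>2)" "\<And>u. u \<in> I \<Longrightarrow> \<kappa>1 u = p"
    by blast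
  have k: "- s * p \<noteq> 0" and k2: "(- s * p)\<^sup>2 = a\<^sup>2 / (4 * b\<^sup>2)"
    using p s(1) by (auto simp: power_mult_distrib)
  have curv: "z2 u / P u ^ 3 = - s * p" if "u \<in> I" for u
    using p(3)[OF that] s(1) by (auto simp: \<kappa>1_def)
  have eps': "- \<epsilon> = 1 \<or> - \<epsilon> = -1" and \<alpha>: "- \<epsilon> * \<eta> = 1 \<or> - \<epsilon> * \<eta> = -1"
    using eps \<eta> by auto
  have radius: "- \<epsilon> * \<eta> / (- s * p)\<^sup>2 - (- \<epsilon> * \<eta>) * - \<epsilon> * x
      = - \<epsilon> * \<eta> * (4 * b\<^sup>2 / a\<^sup>2) - \<eta> * x" for x
    unfolding k2 using eps by auto
  have "\<exists>u0 z0 \<sigma>. (\<sigma> = 1 \<or> \<sigma> = -1) \<and>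
      (\<forall>u\<in>I. - \<epsilon> * \<eta> / (- s * p)\<^sup>2 - (- \<epsilon> * \<eta>) * - \<epsilon> * (u - u0)\<^sup>2 \<ge> 0 \<and>
         z u = z0 + \<sigma> * sqrt (- \<epsilon> * \<eta> / (- s * p)\<^sup>2 - (- \<epsilon> * \<eta>) * - \<epsilon> * (u - u0)\<^sup>2))"
    by (rule constant_curvature_arc[OF I(2) \<alpha> eps' k dz dz1 pos P_def curv])
  moreover have "\<eta> = 1 \<longrightarrow> \<epsilon> = -1"
  proof
    assume "\<eta> = 1"
    moreover obtain u where "u \<in> I"
      using I(3) by auto
    ultimately have "- \<epsilon> * (1 + (z1 u)\<^sup>2) > 0"
      using pos by (auto simp: algebra_simps)
    moreover have "1 + (z1 u)\<^sup>2 > 0"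
      by (simp add: add_pos_nonneg)
    ultimately show "\<epsilon> = -1"
      using eps by auto
  qed
  ultimately show ?thesis
    unfolding radius using ab eps by blast
qed

text \<open>The pole \<open>u0\<close> differs from \<open>0\<close>: otherwise \<open>\<kappa>2 = p\<close>, and the Gauss curvature is constant.\<close>

lemma lightlike_axis_meridian:
  assumes A: "lorentz_matrix A" and z: "profile I z"
    and X: "\<And>u v. u \<in> I \<Longrightarrow> X u v = A *v (rot_lightlike v *v vector [0, u + z u, - u + z u]) + t"
    and W: "nonconstant_weingarten \<epsilon> a b c X I"
  shows "a \<noteq> 0 \<and> b \<noteq> 0 \<and> (\<epsilon> = 1 \<or> \<epsilon> = -1) \<and>
    (\<exists>u0 z0. u0 \<noteq> 0 \<and> (\<forall>u\<in>I. z u = z0 - \<epsilon> * b\<^sup>2 / (a\<^sup>2 * (u - u0))))"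
proof -
  note I = profileD(1-3)[OF z]
  define z1 z2 where "z1 = deriv z" and "z2 = deriv (deriv z)"
  have dz: "(z has_real_derivative z1 u) (at u)" and dz1: "(z1 has_real_derivative z2 u) (at u)"
    if "u \<in> I" for u
    using profileD(4,5)[OF z that] by (simp_all add: z1_def z2_def)
  have cont_z2: "continuous_on I z2"
    using profileD(6)[OF z] by (simp add: z2_def)
  have cont_z1: "continuous_on I z1"
    using dz1 by (meson DERIV_continuous_on has_field_derivative_at_within)
  define Y :: "real \<Rightarrow> real \<Rightarrow> vec3"
    where "Y = (\<lambda>u v. vector [- 2 * u * v, z u + u - u * v\<^sup>2, z u - u - u * v\<^sup>2])"
  define Yu :: "real \<Rightarrow> real \<Rightarrow> vec3"
    where "Yu = (\<lambda>u v. vector [- 2 * v, z1 u + 1 - v\<^sup>2, z1 u - 1 - v\<^sup>2])"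
  define Yv :: "real \<Rightarrow> real \<Rightarrow> vec3"
    where "Yv = (\<lambda>u v. vector [- 2 * u, - (2 * u * v), - (2 * u * v)])"
  define E where "E = (\<lambda>u. 4 * z1 u)"
  define G :: "real \<Rightarrow> real" where "G = (\<lambda>u. 4 * u\<^sup>2)"
  interpret lorentz_matrix A by (fact A)
  interpret rotational_patch A I X Y Yu Yv t E G
  proof
    fix u v assume u: "u \<in> I"
    have "rot_lightlike v *v vector [0, u + z u, - u + z u] = Y u v"
      by (simp add: rot_lightlike_def Y_def vec_eq_iff forall_3 matrix_vector_mult_def sum_3
          field_simps)
    then show "X u v = A *v Y u v + t"
      using X[OF u] by simp
    show "((\<lambda>s. Y s v) has_vector_derivative Yu u v) (at u)"
      unfolding Y_def Yu_def
      by (rule has_vector_derivative_vector3) (auto intro!: derivative_eq_intros dz u)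
    show "((\<lambda>s. Y u s) has_vector_derivative Yv u v) (at v)"
      unfolding Y_def Yv_def
      by (rule has_vector_derivative_vector3) (auto intro!: derivative_eq_intros)
    show "lor (Yu u v) (Yu u v) = E u" "lor (Yu u v) (Yv u v) = 0" "lor (Yv u v) (Yv u v) = G u"
      by (simp_all add: lor_def Yu_def Yv_def E_def G_def power2_eq_square algebra_simps)
    show "E u \<ge> 0 \<or> G u \<ge> 0"
      by (simp add: G_def)
  next
    show "continuous_on I E" "continuous_on I G"
      unfolding E_def G_def by (intro continuous_intros cont_z1)+
  qed (fact I(1,2))+
  note eps = weingarten_causal_sign(1)[OF W] and EG = weingarten_causal_sign(2)[OF W]
  have r0: "u \<noteq> 0" if "u \<in> I" for u
    using EG[OF that] by (auto simp: G_def)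
  have pos: "\<epsilon> * z1 u > 0" if "u \<in> I" for u
  proof -
    have "\<epsilon> * (E u * G u) = (\<epsilon> * z1 u) * (4 * u)\<^sup>2"
      by (simp add: E_def G_def power2_eq_square)
    then show ?thesis
      using EG[OF that] by (simp only: zero_less_mult_iff) (auto dest: power2_less_0[THEN notE])
  qed
  define P where "P = (\<lambda>u. sqrt (\<epsilon> * z1 u))"
  have P_pos: "P u > 0" and z1_eq: "z1 u = \<epsilon> * (P u)\<^sup>2" if "u \<in> I" for u
    using pos[OF that] eps by (auto simp: P_def)
  obtain s :: real where s: "s = 1 \<or> s = -1" "\<And>u. u \<in> I \<Longrightarrow> s * u > 0"
    using continuous_nonzero_sign[OF I(2) continuous_on_id r0] by auto
  have dP: "((\<lambda>u. 1 / P u) has_real_derivative - \<epsilon> * z2 u / (2 * P u ^ 3)) (at u)" if "u \<in> I" for u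
  proof -
    have "(P has_real_derivative \<epsilon> * z2 u / (2 * P u)) (at u)"
      unfolding P_def using pos[OF that]
      by (auto intro!: derivative_eq_intros dz1 that simp: field_simps)
    then show ?thesis
      using P_pos[OF that]
      by (auto intro!: derivative_eq_intros simp: field_simps power3_eq_cube)
  qed
  define N :: "real \<Rightarrow> real \<Rightarrow> vec3" where
    "N = (\<lambda>u v. vector [- s * v * (1 / P u), - s / 2 * ((1 / P u) * (z1 u + (v\<^sup>2 - 1))),
      - s / 2 * ((1 / P u) * (z1 u + (v\<^sup>2 + 1)))])"
  define \<kappa>1 where "\<kappa>1 = (\<lambda>u. - s * z2 u / (4 * P u ^ 3))"
  define \<kappa>2 where "\<kappa>2 = (\<lambda>u. \<epsilon> * s / 2 * (1 / P u) / u)"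
  have N_eq: "N u v = (1 / sqrt (\<epsilon> * (E u * G u))) *\<^sub>R lcross (Yu u v) (Yv u v)" if "u \<in> I" for u v
  proof -
    have EG_eq: "\<epsilon> * (E u * G u) = (\<epsilon> * z1 u) * (4 * (s * u))\<^sup>2"
      using s(1) by (auto simp: E_def G_def power2_eq_square)
    have sq: "sqrt (\<epsilon> * (E u * G u)) = P u * (4 * (s * u))"
      unfolding EG_eq real_sqrt_mult[of "\<epsilon> * z1 u"] P_def real_sqrt_abs
      using s(2)[OF that] by simp
    have "lcross (Yu u v) (Yv u v)
        = (- 2 * u) *\<^sub>R vector [2 * v, z1 u + (v\<^sup>2 - 1), z1 u + (v\<^sup>2 + 1)]"
      by (simp add: lcross_def Yu_def Yv_def vec3_eq_iff algebra_simps power2_eq_square)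
    then show ?thesis
      unfolding sq using s(1) P_pos[OF that] r0[OF that]
      by (auto simp: N_def vec3_eq_iff field_simps)
  qed
  have N_du: "((\<lambda>w. N w v) has_vector_derivative (\<epsilon> * \<kappa>1 u) *\<^sub>R Yu u v) (at u)" if "u \<in> I" for u v
  proof -
    let ?d = "- \<epsilon> * z2 u / (2 * P u ^ 3)"
    have prod: "((\<lambda>w. - s / 2 * ((1 / P w) * (z1 w + k))) has_real_derivative
        - s / 2 * (?d * (z1 u + k) + z2 u * (1 / P u))) (at u)" for k
    proof -
      have "((\<lambda>w. z1 w + k) has_real_derivative z2 u) (at u)"
        using DERIV_add[OF dz1[OF that] DERIV_const[of k]] by simp
      then show ?thesis
        by (intro DERIV_cmult DERIV_mult dP that)
    qed
    have "((\<lambda>w. N w v) has_vector_derivative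
        vector [- s * v * ?d, - s / 2 * (?d * (z1 u + (v\<^sup>2 - 1)) + z2 u * (1 / P u)),
          - s / 2 * (?d * (z1 u + (v\<^sup>2 + 1)) + z2 u * (1 / P u))]) (at u)"
      unfolding N_def by (intro has_vector_derivative_vector3 prod DERIV_cmult dP that)
    moreover have "vector [- s * v * ?d, - s / 2 * (?d * (z1 u + (v\<^sup>2 - 1)) + z2 u * (1 / P u)),
          - s / 2 * (?d * (z1 u + (v\<^sup>2 + 1)) + z2 u * (1 / P u))] = (\<epsilon> * \<kappa>1 u) *\<^sub>R Yu u v"
    proof -
      define D where "D = z2 u / P u ^ 3"
      have d: "?d = - \<epsilon> * D / 2" and \<kappa>1: "\<kappa>1 u = - s * D / 4"
        by (simp_all add: D_def \<kappa>1_def)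
      have z2_P: "z2 u * (1 / P u) = \<epsilon> * D * z1 u"
        using eps P_pos[OF that] by (auto simp: D_def z1_eq[OF that] power3_eq_cube power2_eq_square)
      show ?thesis
        unfolding d \<kappa>1 z2_P by (simp add: Yu_def vec3_eq_iff field_simps)
    qed
    ultimately show ?thesis
      by simp
  qed
  have N_dv: "((\<lambda>w. N u w) has_vector_derivative (\<epsilon> * \<kappa>2 u) *\<^sub>R Yv u v) (at v)" if "u \<in> I" for u v
  proof -
    have "((\<lambda>w. N u w) has_vector_derivative
        vector [- s * (1 / P u), - s * (1 / P u) * v, - s * (1 / P u) * v]) (at v)"
      unfolding N_def using P_pos[OF that]
      by (intro has_vector_derivative_vector3) (auto intro!: derivative_eq_intros)
    moreover have "vector [- s * (1 / P u), - s * (1 / P u) * v, - s * (1 / P u) * v]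
        = (\<epsilon> * \<kappa>2 u) *\<^sub>R Yv u v"
      using eps r0[OF that] by (auto simp: vec3_eq_iff \<kappa>2_def Yv_def)
    ultimately show ?thesis
      by simp
  qed
  have codazzi: "((\<lambda>w. w * \<kappa>2 w) has_real_derivative 1 * \<kappa>1 u) (at u)" if "u \<in> I" for u
  proof -
    have "((\<lambda>w. \<epsilon> * s / 2 * (1 / P w)) has_real_derivative
        \<epsilon> * s / 2 * (- \<epsilon> * z2 u / (2 * P u ^ 3))) (at u)"
      by (intro DERIV_cmult dP that)
    then have "((\<lambda>w. w * \<kappa>2 w) has_real_derivative
        \<epsilon> * s / 2 * (- \<epsilon> * z2 u / (2 * P u ^ 3))) (at u)"
      by (rule has_field_derivative_transform_within_open[OF _ I(1) that]) (simp add: \<kappa>2_def r0)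
    moreover have "\<epsilon> * s / 2 * (- \<epsilon> * z2 u / (2 * P u ^ 3)) = 1 * \<kappa>1 u"
      using eps by (auto simp: \<kappa>1_def)
    ultimately show ?thesis
      by simp
  qed
  have cont: "continuous_on I \<kappa>1"
    unfolding \<kappa>1_def P_def
    by (intro continuous_intros cont_z1 cont_z2) (use pos in fastforce)
  have ab: "a \<noteq> 0" "b \<noteq> 0"
    and "\<exists>p. p \<noteq> 0 \<and> p\<^sup>2 = a\<^sup>2 / (4 * b\<^sup>2) \<and> (\<forall>u\<in>I. \<kappa>1 u = p \<and> \<kappa>2 u \<noteq> p)"
    by (rule meridian_curvature[OF W N_eq N_du N_dv r0 DERIV_ident codazzi cont]; simp)+
  then obtain p where p: "p \<noteq> 0" "p\<^sup>2 = a\<^sup>2 / (4 * b\<^sup>2)"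
    "\<And>u. u \<in> I \<Longrightarrow> \<kappa>1 u = p" "\<And>u. u \<in> I \<Longrightarrow> \<kappa>2 u \<noteq> p"
    by blast
  have slope: "2 * \<epsilon> * s * p \<noteq> 0"
    using p(1) s(1) eps by auto
  have "((\<lambda>u. 1 / P u) has_real_derivative (2 * \<epsilon> * s * p) * 1) (at u)" if "u \<in> I" for u
    using dP[OF that] unfolding p(3)[OF that, symmetric] \<kappa>1_def using s(1) by auto
  then have "\<exists>u0. \<forall>u\<in>I. 1 / P u = 2 * \<epsilon> * s * p * (u - u0)"
    by (rule affine_of_constant_derivative[OF I(2) _ DERIV_ident slope])
  then obtain u0 where u0: "\<And>u. u \<in> I \<Longrightarrow> 1 / P u = 2 * \<epsilon> * s * p * (u - u0)"
    by blast
  have u0_notin: "u \<noteq> u0" if "u \<in> I" for u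
    using u0[OF that] P_pos[OF that] by auto
  have u0_nonzero: "u0 \<noteq> 0"
  proof
    assume "u0 = 0"
    then have "\<kappa>2 u = p" if "u \<in> I" for u
      unfolding \<kappa>2_def u0[OF that] using r0[OF that] s(1) eps by auto
    then show False
      using p(4) I(3) by blast
  qed
  define k where "k = \<epsilon> * b\<^sup>2 / a\<^sup>2"
  have z1_k: "z1 u = k * (1 / (u - u0)\<^sup>2)" if "u \<in> I" for u
  proof -
    have "(1 / P u)\<^sup>2 = 4 * p\<^sup>2 * (u - u0)\<^sup>2"
      unfolding u0[OF that] using s(1) eps by (auto simp: power_mult_distrib)
    also have "\<dots> = a\<^sup>2 * (u - u0)\<^sup>2 / b\<^sup>2"
      by (simp add: p(2))
    finally have "(P u)\<^sup>2 = b\<^sup>2 / (a\<^sup>2 * (u - u0)\<^sup>2)"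
      using P_pos[OF that] ab u0_notin[OF that] by (simp add: power_divide field_simps)
    then show ?thesis
      by (simp add: z1_eq[OF that] k_def)
  qed
  have "((\<lambda>u. z u + k * (1 / (u - u0))) has_real_derivative 0) (at u)" if "u \<in> I" for u
  proof -
    have "((\<lambda>u. 1 / (u - u0)) has_real_derivative - (1 / (u - u0)\<^sup>2)) (at u)"
      using u0_notin[OF that] by (auto intro!: derivative_eq_intros simp: power2_eq_square)
    from DERIV_add[OF dz[OF that] DERIV_cmult[OF this, of k]] show ?thesis
      by (simp add: z1_k[OF that])
  qed
  then obtain z0 where "\<And>u. u \<in> I \<Longrightarrow> z u + k * (1 / (u - u0)) = z0"
    using constant_of_zero_derivative[OF I(2), of "\<lambda>u. z u + k * (1 / (u - u0))"] by blast
  then have "\<forall>u\<in>I. z u = z0 - k * (1 / (u - u0))"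
    by (simp add: eq_diff_eq)
  then have "\<forall>u\<in>I. z u = z0 - \<epsilon> * b\<^sup>2 / (a\<^sup>2 * (u - u0))"
    by (simp add: k_def)
  then show ?thesis
    using ab eps u0_nonzero by blast
qed

section \<open>Normal forms of the surface\<close>

lemma surface_of_eq: "surface_of I X = (\<lambda>x. X (fst x) (snd x)) ` (I \<times> UNIV)"
  by (force simp: surface_of_def)

lemma surface_of_image:
  assumes "\<And>u v. u \<in> I \<Longrightarrow> T (X u v) = Y u v"
  shows "T ` surface_of I X = surface_of I Y"
  unfolding surface_of_eq image_image using assms by (intro image_cong) auto

lemma surface_of_reparametrize:
  assumes Y: "\<And>u v. u \<in> I \<Longrightarrow> Y u v = X (\<phi> u) (\<psi> v)" and "surj \<psi>"
  shows "surface_of I Y = surface_of (\<phi> ` I) X"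
proof -
  have "X (\<phi> u) v \<in> surface_of I Y" if u: "u \<in> I" for u v
  proof -
    obtain w where "v = \<psi> w"
      using \<open>surj \<psi>\<close> by (rule surjE)
    then have "X (\<phi> u) v = Y u w"
      by (simp add: Y[OF u])
    then show ?thesis
      using u by (auto simp: surface_of_def)
  qed
  moreover have "Y u v \<in> surface_of (\<phi> ` I) X" if "u \<in> I" for u v
    using that by (auto simp: surface_of_def Y)
  ultimately show ?thesis
    by (auto simp: surface_of_def[of I Y] surface_of_def[of "\<phi> ` I" X])
qed

lemma sign_of_quotient:
  fixes a x :: real
  assumes "a \<noteq> 0"
  shows "\<bar>a * x\<bar> / a = x \<or> \<bar>a * x\<bar> / a = - x"
  using assms by (auto simp: abs_if)

lemma timelike_axis_normal_form:
  assumes \<Phi>: "rigid_motion \<Phi>" and z: "profile I z"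
    and X: "\<forall>u\<in>I. \<forall>v. X u v = \<Phi> (rot_timelike v *v vector [u, 0, z u])"
    and W: "nonconstant_weingarten \<epsilon> a b c X I"
  shows "\<exists>T J z \<mu> l C s1 s2. rigid_motion T \<and> profile J z \<and> s1 \<in> {1, -1} \<and> s2 \<in> {1, -1} \<and>
          T ` surface_of I X = surface_of J (\<lambda>u v. vector [u * cos v, u * sin v, z u]) \<and>
          b * \<epsilon> * (- b + l) \<ge> 0 \<and> C = 2 * sqrt (b * \<epsilon> * (- b + l)) \<and>
          (\<forall>u\<in>J. 4 * \<epsilon> * b\<^sup>2 / a\<^sup>2 + (C / a + s1 * u)\<^sup>2 \<ge> 0 \<and>
             z u = s2 * sqrt (4 * \<epsilon> * b\<^sup>2 / a\<^sup>2 + (C / a + s1 * u)\<^sup>2) + \<mu>)"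
proof -
  obtain A t where A: "lorentz_matrix A" and \<Phi>_eq: "\<Phi> = (\<lambda>x. A *v x + t)"
    using \<Phi> by (auto simp: rigid_motion_iff)
  obtain T where T: "rigid_motion T" "\<And>x. T (\<Phi> x) = x"
    using rigid_motion_inverse[OF \<Phi>] by blast
  have ab: "a \<noteq> 0" "b \<noteq> 0" and eps: "\<epsilon> = 1 \<or> \<epsilon> = -1"
    and "\<exists>u0 z0 \<sigma>. (\<sigma> = 1 \<or> \<sigma> = -1) \<and>
      (\<forall>u\<in>I. 4 * \<epsilon> * b\<^sup>2 / a\<^sup>2 + (u - u0)\<^sup>2 \<ge> 0 \<and>
        z u = z0 + \<sigma> * sqrt (4 * \<epsilon> * b\<^sup>2 / a\<^sup>2 + (u - u0)\<^sup>2))"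
    using timelike_axis_meridian[OF A z _ W, of t] X by (auto simp: \<Phi>_eq)
  then obtain u0 z0 \<sigma> where \<sigma>: "\<sigma> = 1 \<or> \<sigma> = -1"
    and zu: "\<And>u. u \<in> I \<Longrightarrow> 4 * \<epsilon> * b\<^sup>2 / a\<^sup>2 + (u - u0)\<^sup>2 \<ge> 0 \<and>
        z u = z0 + \<sigma> * sqrt (4 * \<epsilon> * b\<^sup>2 / a\<^sup>2 + (u - u0)\<^sup>2)"
    by blast
  \<comment> \<open>The parameter \<open>l\<close> is chosen so that \<open>2 \<surd>(b \<epsilon> (l - b)) = \<bar>a u0\<bar>\<close>.\<close>
  define C where "C = \<bar>a * u0\<bar>"
  define l where "l = b + (a * u0 / 2)\<^sup>2 / (b * \<epsilon>)"
  have l: "b * \<epsilon> * (- b + l) = (a * u0 / 2)\<^sup>2"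
    using ab eps by (auto simp: l_def)
  have C: "2 * sqrt (b * \<epsilon> * (- b + l)) = C" "b * \<epsilon> * (- b + l) \<ge> 0"
    unfolding l by (simp_all add: C_def)
  have "\<exists>s1\<in>{1,-1}. \<forall>u. (C / a + s1 * u)\<^sup>2 = (u - u0)\<^sup>2"
    using sign_of_quotient[OF ab(1), of u0]
  proof
    assume "\<bar>a * u0\<bar> / a = u0"
    then show ?thesis
      by (intro bexI[of _ "-1"]) (auto simp: C_def power2_commute)
  next
    assume "\<bar>a * u0\<bar> / a = - u0"
    then show ?thesis
      by (intro bexI[of _ 1]) (auto simp: C_def)
  qed
  then obtain s1 where s1: "s1 \<in> {1,-1}" "\<And>u. (C / a + s1 * u)\<^sup>2 = (u - u0)\<^sup>2"
    by blast
  have "T ` surface_of I X = surface_of I (\<lambda>u v. vector [u * cos v, - (u * sin v), z u])"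
    by (rule surface_of_image)
       (simp add: X T(2) rot_timelike_def vec_eq_iff forall_3 matrix_vector_mult_def sum_3)
  \<comment> \<open>Substituting \<open>- v\<close> for \<open>v\<close> does not change the surface as a set.\<close>
  also have "\<dots> = surface_of I (\<lambda>u v. vector [u * cos v, u * sin v, z u])"
    using surface_of_reparametrize[where \<phi> = "\<lambda>u. u" and \<psi> = uminus and I = I] by simp
  finally have image: "T ` surface_of I X = \<dots>" .
  show ?thesis
    by (rule exI[of _ T], rule exI[of _ I], rule exI[of _ z], rule exI[of _ z0],
        rule exI[of _ l], rule exI[of _ C], rule exI[of _ s1],
        rule exI[of _ \<sigma>])
       (use \<sigma> zu s1 T(1) z image C in \<open>simp add: s1(2)\<close>)
qed

lemma spacelike_axis_normal_form_a:
  assumes \<Phi>: "rigid_motion \<Phi>" and z: "profile I z"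
    and X: "\<forall>u\<in>I. \<forall>v. X u v = \<Phi> (rot_spacelike v *v vector [u, 0, z u])"
    and W: "nonconstant_weingarten \<epsilon> a b c X I"
  shows "\<exists>T J z \<mu> l C s1 s2 s3 s4. rigid_motion T \<and> profile J z \<and>
          s1 \<in> {1, -1} \<and> s2 \<in> {1, -1} \<and> s3 \<in> {1, -1} \<and> s4 \<in> {1, -1} \<and>
          T ` surface_of I X = surface_of J (\<lambda>u v. vector [u, z u * sinh v, z u * cosh v]) \<and>
          b * \<epsilon> * l \<ge> 0 \<and> C = 2 * sqrt (b * \<epsilon> * l) \<and>
          (\<forall>u\<in>J. 4 * \<epsilon> * b\<^sup>2 / a\<^sup>2 + s3 * (u + s4 * \<mu>)\<^sup>2 \<ge> 0 \<and>
             z u = s1 * (C / a) + s2 * sqrt (4 * \<epsilon> * b\<^sup>2 / a\<^sup>2 + s3 * (u + s4 * \<mu>)\<^sup>2))"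
proof -
  obtain A t where A: "lorentz_matrix A" and \<Phi>_eq: "\<Phi> = (\<lambda>x. A *v x + t)"
    using \<Phi> by (auto simp: rigid_motion_iff)
  obtain T where T: "rigid_motion T" "\<And>x. T (\<Phi> x) = x"
    using rigid_motion_inverse[OF \<Phi>] by blast
  have rot: "rot_spacelike v *v vector [u, 0, z u] = vector [u, z u * sinh v, z u * cosh v]" for u v
    by (simp add: rot_spacelike_def vec_eq_iff forall_3 matrix_vector_mult_def sum_3 mult.commute)
  have "a \<noteq> 0 \<and> b \<noteq> 0 \<and> (\<epsilon> = 1 \<or> \<epsilon> = -1) \<and> (- 1 = (1 :: real) \<longrightarrow> \<epsilon> = -1) \<and>
    (\<exists>u0 z0 \<sigma>. (\<sigma> = 1 \<or> \<sigma> = -1) \<and>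
      (\<forall>u\<in>I. - \<epsilon> * - 1 * (4 * b\<^sup>2 / a\<^sup>2) - - 1 * (u - u0)\<^sup>2 \<ge> 0 \<and>
        z u = z0 + \<sigma> * sqrt (- \<epsilon> * - 1 * (4 * b\<^sup>2 / a\<^sup>2) - - 1 * (u - u0)\<^sup>2)))"
  proof (rule spacelike_axis_meridian[OF A z, of X sinh cosh t])
    show "X u v = A *v vector [u, z u * sinh v, z u * cosh v] + t" if "u \<in> I" for u v
      using that by (simp add: X rot \<Phi>_eq)
    show "(sinh has_real_derivative cosh v) (at v)" "(cosh has_real_derivative sinh v) (at v)" for v :: real
      by (auto intro!: derivative_eq_intros)
    show "sinh v * sinh v - cosh v * cosh v = -1" for v :: real
      using cosh_square_eq[of v] by (simp add: power2_eq_square)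
  qed (use W in auto)
  then have ab: "a \<noteq> 0" "b \<noteq> 0" and eps: "\<epsilon> = 1 \<or> \<epsilon> = -1"
    and ex: "\<exists>u0 z0 \<sigma>. (\<sigma> = 1 \<or> \<sigma> = -1) \<and>
      (\<forall>u\<in>I. - \<epsilon> * - 1 * (4 * b\<^sup>2 / a\<^sup>2) - - 1 * (u - u0)\<^sup>2 \<ge> 0 \<and>
        z u = z0 + \<sigma> * sqrt (- \<epsilon> * - 1 * (4 * b\<^sup>2 / a\<^sup>2) - - 1 * (u - u0)\<^sup>2))"
    by simp_all
  have "- \<epsilon> * - 1 * (4 * b\<^sup>2 / a\<^sup>2) - - 1 * x = 4 * \<epsilon> * b\<^sup>2 / a\<^sup>2 + x" for x
    by simp
  from ex[unfolded this] obtain u0 z0 \<sigma> where \<sigma>: "\<sigma> = 1 \<or> \<sigma> = -1"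
    and zu: "\<And>u. u \<in> I \<Longrightarrow> 4 * \<epsilon> * b\<^sup>2 / a\<^sup>2 + (u - u0)\<^sup>2 \<ge> 0 \<and>
        z u = z0 + \<sigma> * sqrt (4 * \<epsilon> * b\<^sup>2 / a\<^sup>2 + (u - u0)\<^sup>2)"
    by blast
  define C where "C = \<bar>a * z0\<bar>"
  define l where "l = (a * z0 / 2)\<^sup>2 / (b * \<epsilon>)"
  have l: "b * \<epsilon> * l = (a * z0 / 2)\<^sup>2"
    using ab eps by (auto simp: l_def)
  have C: "2 * sqrt (b * \<epsilon> * l) = C" "b * \<epsilon> * l \<ge> 0"
    unfolding l by (simp_all add: C_def)
  obtain s1 where s1: "s1 \<in> {1,-1}" "s1 * (C / a) = z0"
    using sign_of_quotient[OF ab(1), of z0] unfolding C_def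
    by (metis insertCI minus_minus mult_1 mult_minus1)
  have image: "T ` surface_of I X = surface_of I (\<lambda>u v. vector [u, z u * sinh v, z u * cosh v])"
    by (rule surface_of_image) (simp add: X T(2) rot)
  show ?thesis
    by (rule exI[of _ T], rule exI[of _ I], rule exI[of _ z], rule exI[of _ u0],
        rule exI[of _ l], rule exI[of _ C], rule exI[of _ s1],
        rule exI[of _ \<sigma>], rule exI[of _ 1], rule exI[of _ "-1"])
       (use \<sigma> zu s1 T(1) z image C in simp)
qed

lemma spacelike_axis_normal_form_b:
  assumes \<Phi>: "rigid_motion \<Phi>" and z: "profile I z"
    and X: "\<forall>u\<in>I. \<forall>v. X u v = \<Phi> (rot_spacelike v *v vector [u, z u, 0])"
    and W: "nonconstant_weingarten \<epsilon> a b c X I"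
  shows "\<exists>T J z \<mu> l C s1 s2 s3. rigid_motion T \<and> profile J z \<and>
          s1 \<in> {1, -1} \<and> s2 \<in> {1, -1} \<and> s3 \<in> {1, -1} \<and>
          T ` surface_of I X = surface_of J (\<lambda>u v. vector [u, z u * cosh v, z u * sinh v]) \<and>
          b * l \<ge> 0 \<and> C = 2 * sqrt (b * l) \<and>
          (\<forall>u\<in>J. 4 * b\<^sup>2 / a\<^sup>2 + s2 * (u + s3 * \<mu>)\<^sup>2 \<ge> 0 \<and>
             z u = - C / a + s1 * sqrt (4 * b\<^sup>2 / a\<^sup>2 + s2 * (u + s3 * \<mu>)\<^sup>2))"
proof -
  obtain A t where A: "lorentz_matrix A" and \<Phi>_eq: "\<Phi> = (\<lambda>x. A *v x + t)"
    using \<Phi> by (auto simp: rigid_motion_iff)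
  obtain T where T: "rigid_motion T" "\<And>x. T (\<Phi> x) = x"
    using rigid_motion_inverse[OF \<Phi>] by blast
  have rot: "rot_spacelike v *v vector [u, z u, 0] = vector [u, z u * cosh v, z u * sinh v]" for u v
    by (simp add: rot_spacelike_def vec_eq_iff forall_3 matrix_vector_mult_def sum_3 mult.commute)
  have "a \<noteq> 0 \<and> b \<noteq> 0 \<and> (\<epsilon> = 1 \<or> \<epsilon> = -1) \<and> (1 = (1 :: real) \<longrightarrow> \<epsilon> = -1) \<and>
    (\<exists>u0 z0 \<sigma>. (\<sigma> = 1 \<or> \<sigma> = -1) \<and>
      (\<forall>u\<in>I. - \<epsilon> * 1 * (4 * b\<^sup>2 / a\<^sup>2) - 1 * (u - u0)\<^sup>2 \<ge> 0 \<and>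
        z u = z0 + \<sigma> * sqrt (- \<epsilon> * 1 * (4 * b\<^sup>2 / a\<^sup>2) - 1 * (u - u0)\<^sup>2)))"
  proof (rule spacelike_axis_meridian[OF A z, of X cosh sinh t])
    show "X u v = A *v vector [u, z u * cosh v, z u * sinh v] + t" if "u \<in> I" for u v
      using that by (simp add: X rot \<Phi>_eq)
    show "(cosh has_real_derivative sinh v) (at v)" "(sinh has_real_derivative cosh v) (at v)" for v :: real
      by (auto intro!: derivative_eq_intros)
    show "cosh v * cosh v - sinh v * sinh v = 1" for v :: real
      using cosh_square_eq[of v] by (simp add: power2_eq_square)
  qed (use W in auto)
  then have ab: "a \<noteq> 0" "b \<noteq> 0" and eps: "\<epsilon> = -1"
    and ex: "\<exists>u0 z0 \<sigma>. (\<sigma> = 1 \<or> \<sigma> = -1) \<and>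
      (\<forall>u\<in>I. - \<epsilon> * 1 * (4 * b\<^sup>2 / a\<^sup>2) - 1 * (u - u0)\<^sup>2 \<ge> 0 \<and>
        z u = z0 + \<sigma> * sqrt (- \<epsilon> * 1 * (4 * b\<^sup>2 / a\<^sup>2) - 1 * (u - u0)\<^sup>2))"
    by blast+
  have "- \<epsilon> * 1 * (4 * b\<^sup>2 / a\<^sup>2) - 1 * x = 4 * b\<^sup>2 / a\<^sup>2 - x" for x
    by (simp add: eps)
  from ex[unfolded this] obtain u0 z0 \<sigma> where \<sigma>: "\<sigma> = 1 \<or> \<sigma> = -1"
    and zu: "\<And>u. u \<in> I \<Longrightarrow> 4 * b\<^sup>2 / a\<^sup>2 - (u - u0)\<^sup>2 \<ge> 0 \<and>
        z u = z0 + \<sigma> * sqrt (4 * b\<^sup>2 / a\<^sup>2 - (u - u0)\<^sup>2)"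
    by blast
  define C where "C = \<bar>a * z0\<bar>"
  define l where "l = (a * z0 / 2)\<^sup>2 / b"
  have l: "b * l = (a * z0 / 2)\<^sup>2"
    using ab by (simp add: l_def)
  have C: "2 * sqrt (b * l) = C" "b * l \<ge> 0"
    by (simp_all add: l C_def)
  from sign_of_quotient[OF ab(1), of z0] show ?thesis
  proof
    assume "\<bar>a * z0\<bar> / a = - z0"
    then have z0: "- C / a = z0"
      by (simp add: C_def)
    have image: "T ` surface_of I X = surface_of I (\<lambda>u v. vector [u, z u * cosh v, z u * sinh v])"
      by (rule surface_of_image) (simp add: X T(2) rot)
    show ?thesis
      by (rule exI[of _ T], rule exI[of _ I], rule exI[of _ z], rule exI[of _ u0],
        rule exI[of _ l], rule exI[of _ C], rule exI[of _ \<sigma>],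
        rule exI[of _ "-1"], rule exI[of _ "-1"])
       (use \<sigma> zu z0 T(1) z image C in simp)
  next
    \<comment> \<open>The half-turn about the axis replaces \<open>z\<close> by \<open>- z\<close>.\<close>
    assume "\<bar>a * z0\<bar> / a = z0"
    then have z0: "- C / a = - z0"
      by (simp add: C_def)
    define R :: "real^3^3" where
      "R = vector [vector [1, 0, 0], vector [0, -1, 0], vector [0, 0, -1]]"
    have R: "R *v vector [i, j, k] = vector [i, - j, - k]" for i j k
      by (simp add: R_def vec_eq_iff forall_3 matrix_vector_mult_def sum_3)
    have "lorentz_matrix R"
      by unfold_locales (simp add: R_def lor_def matrix_vector_mult_def sum_3)
    then have RT: "rigid_motion (\<lambda>x. R *v T x)"
      using T(1) by (rule rigid_motion_matrix_comp)
    have image: "(\<lambda>x. R *v T x) ` surface_of I X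
        = surface_of I (\<lambda>u v. vector [u, - z u * cosh v, - z u * sinh v])"
      by (rule surface_of_image) (simp add: X T(2) rot R)
    have profile: "profile I (\<lambda>u. - z u)"
      using profileD[OF z]
      by (intro profileI[of I _ "\<lambda>u. - deriv z u" "\<lambda>u. - deriv (deriv z) u"])
         (auto intro!: DERIV_minus continuous_intros)
    show ?thesis
      by (rule exI[of _ "\<lambda>x. R *v T x"], rule exI[of _ I],
        rule exI[of _ "\<lambda>u. - z u"], rule exI[of _ u0], rule exI[of _ l],
        rule exI[of _ C], rule exI[of _ "- \<sigma>"], rule exI[of _ "-1"],
        rule exI[of _ "-1"])
       (use \<sigma> zu z0 RT profile image C in auto)
  qed
qed

text \<open>For \<open>a\<^sup>2 = 4 b c \<epsilon>\<close> and \<open>C\<^sup>2 = - 8 b \<epsilon> l\<close> the coefficient \<open>c C\<^sup>2 + 2 a\<^sup>2 l\<close> of \<open>y\<close> vanishes, and the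
  common zero \<open>u = - C / a\<close> of the numerator and the denominator cancels.\<close>

lemma lightlike_formula:
  assumes ab: "a \<noteq> 0" "b \<noteq> 0" and eps: "\<epsilon> = 1 \<or> \<epsilon> = (-1 :: real)"
    and discr: "a\<^sup>2 - 4 * b * c * \<epsilon> = 0" and C: "C\<^sup>2 = - 8 * b * \<epsilon> * l" "C \<noteq> 0"
    and u: "2 * l + c * u\<^sup>2 \<noteq> 0"
  shows "1 / 64 * ((- 4 * a * C * l + (c * C\<^sup>2 - 2 * a\<^sup>2 * l) * u) / (\<epsilon> * c * l * (2 * l + c * u\<^sup>2))
      + \<epsilon> * ((c * C\<^sup>2 + 2 * a\<^sup>2 * l) / sqrt (- 2 * c * l)) * y)
    = - (\<epsilon> * b\<^sup>2 / (a\<^sup>2 * (u - C / a)))"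
proof -
  have eps2: "\<epsilon> * \<epsilon> = 1"
    using eps by auto
  have a2: "a\<^sup>2 = 4 * b * c * \<epsilon>"
    using discr by simp
  have cC: "c * C\<^sup>2 = - 2 * a\<^sup>2 * l"
    by (simp add: C(1) a2)
  have c0: "c \<noteq> 0" and l0: "l \<noteq> 0"
    using a2 ab C by auto
  have "4 * b * \<epsilon> * (2 * l + c * u\<^sup>2) = a\<^sup>2 * u\<^sup>2 - C\<^sup>2"
    by (simp add: C(1) a2 algebra_simps)
  then have xy: "4 * b * \<epsilon> * (2 * l + c * u\<^sup>2) = (a * u - C) * (a * u + C)"
    by (simp add: power2_eq_square algebra_simps)
  have eb: "4 * b * \<epsilon> \<noteq> 0"
    using ab eps by auto
  then have x0: "a * u - C \<noteq> 0" and y0: "a * u + C \<noteq> 0"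
    using xy u by auto
  have den: "2 * l + c * u\<^sup>2 = (a * u - C) * (a * u + C) / (4 * b * \<epsilon>)"
    using xy eb by (simp add: nonzero_eq_divide_eq mult.commute)
  have "(- 4 * a * C * l + (c * C\<^sup>2 - 2 * a\<^sup>2 * l) * u) / (\<epsilon> * c * l * (2 * l + c * u\<^sup>2))
      = (- 4 * a * l * (a * u + C)) / (\<epsilon> * c * l * (2 * l + c * u\<^sup>2))"
    unfolding cC by (simp add: power2_eq_square algebra_simps)
  also have "\<dots> = - 16 * a * b / (c * (a * u - C))"
    unfolding den using c0 l0 x0 y0 eb eps by (auto simp: divide_simps)
  also have "\<dots> = - 64 * \<epsilon> * b\<^sup>2 / (a * (a * u - C))"
  proof -
    have "16 * a * b * (a * (a * u - C)) = 16 * b * a\<^sup>2 * (a * u - C)"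
      by (simp add: power2_eq_square)
    also have "\<dots> = 64 * \<epsilon> * b\<^sup>2 * (c * (a * u - C))"
      unfolding a2 by (simp add: power2_eq_square)
    finally have "16 * a * b * (a * (a * u - C)) = 64 * \<epsilon> * b\<^sup>2 * (c * (a * u - C))" .
    then show ?thesis
      using c0 x0 ab by (simp add: frac_eq_eq)
  qed
  also have "a * (a * u - C) = a\<^sup>2 * (u - C / a)"
    using ab by (simp add: power2_eq_square algebra_simps)
  finally show ?thesis
    by (simp add: cC)
qed

lemma lightlike_axis_normal_form:
  assumes \<Phi>: "rigid_motion \<Phi>" and z: "profile I z"
    and X: "\<forall>u\<in>I. \<forall>v. X u v = \<Phi> (rot_lightlike v *v vector [0, u + z u, - u + z u])"
    and W: "nonconstant_weingarten \<epsilon> a b c X I"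
  shows "\<exists>T J z \<mu> l C. rigid_motion T \<and> profile J z \<and>
          T ` surface_of I X = surface_of J
            (\<lambda>u v. vector [- 2 * u * v, z u + u - u * v\<^sup>2, z u - u - u * v\<^sup>2]) \<and>
          - 8 * b * \<epsilon> * l \<ge> 0 \<and> C = sqrt (- 8 * b * \<epsilon> * l) \<and> - 2 * c * l > 0 \<and>
          (\<forall>u\<in>J. 2 * l + c * u\<^sup>2 \<noteq> 0 \<longrightarrow>
             z u = 1 / 64 * ((- 4 * a * C * l + (c * C\<^sup>2 - 2 * a\<^sup>2 * l) * u)
                               / (\<epsilon> * c * l * (2 * l + c * u\<^sup>2))
                             + \<epsilon> * ((c * C\<^sup>2 + 2 * a\<^sup>2 * l) / sqrt (- 2 * c * l))
                                 * artanh (sqrt (- (c / (2 * l))) * u)) + \<mu>)"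
proof -
  obtain A t where A: "lorentz_matrix A" and \<Phi>_eq: "\<Phi> = (\<lambda>x. A *v x + t)"
    using \<Phi> by (auto simp: rigid_motion_iff)
  obtain T where T: "rigid_motion T" "\<And>x. T (\<Phi> x) = x"
    using rigid_motion_inverse[OF \<Phi>] by blast
  have ab: "a \<noteq> 0" "b \<noteq> 0" and eps: "\<epsilon> = 1 \<or> \<epsilon> = -1"
    and "\<exists>u0 z0. u0 \<noteq> 0 \<and> (\<forall>u\<in>I. z u = z0 - \<epsilon> * b\<^sup>2 / (a\<^sup>2 * (u - u0)))"
    using lightlike_axis_meridian[OF A z _ W, of t] X by (auto simp: \<Phi>_eq)
  then obtain u0 z0 where u0: "u0 \<noteq> 0"
    and zu: "\<And>u. u \<in> I \<Longrightarrow> z u = z0 - \<epsilon> * b\<^sup>2 / (a\<^sup>2 * (u - u0))"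
    by blast
  have discr: "a\<^sup>2 - 4 * b * c * \<epsilon> = 0"
    using W by (simp add: nonconstant_weingarten_def)
  define C where "C = \<bar>a * u0\<bar>"
  define l where "l = - \<epsilon> * C\<^sup>2 / (8 * b)"
  have C0: "C > 0"
    using ab u0 by (simp add: C_def)
  have C2: "C\<^sup>2 = - 8 * b * \<epsilon> * l"
    using ab eps by (auto simp: l_def)
  have C: "- 8 * b * \<epsilon> * l \<ge> 0" "C = sqrt (- 8 * b * \<epsilon> * l)"
    unfolding C2[symmetric] using C0 by simp_all
  have "- 2 * c * l * (4 * b)\<^sup>2 = (4 * b * c * \<epsilon>) * C\<^sup>2"
    using ab by (simp add: l_def power2_eq_square)
  also have "\<dots> = a\<^sup>2 * C\<^sup>2"
    using discr by simp
  finally have "- 2 * c * l * (4 * b)\<^sup>2 > 0"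
    using ab C0 by simp
  then have cl: "- 2 * c * l > 0"
    by (simp only: zero_less_mult_iff) (auto dest: power2_less_0[THEN notE])
  note formula = lightlike_formula[OF ab eps discr C2 C0[THEN less_imp_neq, symmetric]]
  have rot: "rot_lightlike v *v vector [0, u + z u, - u + z u]
      = vector [- 2 * u * v, z u + u - u * v\<^sup>2, z u - u - u * v\<^sup>2]" for u v
    by (simp add: rot_lightlike_def vec_eq_iff forall_3 matrix_vector_mult_def sum_3 field_simps)
  from sign_of_quotient[OF ab(1), of u0] show ?thesis
  proof
    assume "\<bar>a * u0\<bar> / a = u0"
    then have "C / a = u0"
      by (simp add: C_def)
    note formula = formula[unfolded this]
    have image: "T ` surface_of I X
        = surface_of I (\<lambda>u v. vector [- 2 * u * v, z u + u - u * v\<^sup>2, z u - u - u * v\<^sup>2])"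
      by (rule surface_of_image) (simp only: X T(2) rot)
    show ?thesis
      by (rule exI[of _ T], rule exI[of _ I], rule exI[of _ z], rule exI[of _ z0],
        rule exI[of _ l], rule exI[of _ C],
        intro conjI T(1) z image C cl ballI impI)
       (simp only: formula zu not_False_eq_True)
  next
    \<comment> \<open>The point reflection replaces \<open>u\<close> by \<open>- u\<close> and \<open>z\<close> by \<open>\<lambda>u. - z (- u)\<close>.\<close>
    assume "\<bar>a * u0\<bar> / a = - u0"
    then have "C / a = - u0"
      by (simp add: C_def)
    note formula = formula[unfolded this]
    define R :: "real^3^3" where
      "R = vector [vector [-1, 0, 0], vector [0, -1, 0], vector [0, 0, -1]]"
    have R: "R *v x = - x" for x
      by (simp add: R_def vec_eq_iff forall_3 matrix_vector_mult_def sum_3)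
    have "lorentz_matrix R"
      by unfold_locales (simp add: R lor_def)
    then have RT: "rigid_motion (\<lambda>x. R *v T x)"
      using T(1) by (rule rigid_motion_matrix_comp)
    have "(\<lambda>x. R *v T x) ` surface_of I X
        = surface_of I (\<lambda>u v. - vector [- 2 * u * v, z u + u - u * v\<^sup>2, z u - u - u * v\<^sup>2])"
      by (rule surface_of_image) (simp only: X T(2) rot R)
    also have "\<dots> = surface_of (uminus ` I)
        (\<lambda>u v. vector [- 2 * u * v, - z (- u) + u - u * v\<^sup>2, - z (- u) - u - u * v\<^sup>2])"
      by (rule surface_of_reparametrize[where \<psi> = "\<lambda>v. v"]) (simp_all add: vec3_eq_iff)
    finally have image: "(\<lambda>x. R *v T x) ` surface_of I X = \<dots>" .
    have profile: "profile (uminus ` I) (\<lambda>u. - z (- u))"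
    proof (rule profileI)
      show "open (uminus ` I)" "uminus ` I \<noteq> {}"
        using profileD(1,3)[OF z] by (auto simp: open_negations)
      show "is_interval (uminus ` I)"
        using profileD(2)[OF z] by simp
      fix u assume "u \<in> uminus ` I"
      then have u: "- u \<in> I"
        by auto
      show "((\<lambda>u. - z (- u)) has_real_derivative deriv z (- u)) (at u)"
        using DERIV_minus[OF DERIV_chain'[OF DERIV_minus[OF DERIV_ident] profileD(4)[OF z u]]] by simp
      show "((\<lambda>u. deriv z (- u)) has_real_derivative - deriv (deriv z) (- u)) (at u)"
        using DERIV_chain'[OF DERIV_minus[OF DERIV_ident] profileD(5)[OF z u]] by simp
    next
      show "continuous_on (uminus ` I) (\<lambda>u. - deriv (deriv z) (- u))"
        by (intro continuous_intros continuous_on_compose2[OF profileD(6)[OF z]]) auto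
    qed
    have flipped: "- z (- u) = - (\<epsilon> * b\<^sup>2 / (a\<^sup>2 * (u - - u0))) + - z0" if "u \<in> uminus ` I" for u
    proof -
      have "a\<^sup>2 * (- u - u0) = - (a\<^sup>2 * (u - - u0))"
        by (simp add: algebra_simps)
      then show ?thesis
        using that zu by auto
    qed
    show ?thesis
      by (rule exI[of _ "\<lambda>x. R *v T x"], rule exI[of _ "uminus ` I"],
        rule exI[of _ "\<lambda>u. - z (- u)"], rule exI[of _ "- z0"],
        rule exI[of _ l], rule exI[of _ C],
        intro conjI RT profile image C cl ballI impI) 
       (simp only: formula flipped not_False_eq_True)
  qed
qed

lemma axis_type:
  assumes "rigid_motion \<Phi>" and L: "L = \<Phi> ` span {e}"
  shows "timelike_line L \<Longrightarrow> lor e e < 0" "spacelike_line L \<Longrightarrow> lor e e > 0"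
    and "lightlike_line L \<Longrightarrow> lor e e = 0"
proof -
  have *: "(lor d d < 0 \<longleftrightarrow> lor e e < 0) \<and> (lor d d > 0 \<longleftrightarrow> lor e e > 0) \<and> (lor d d = 0 \<longleftrightarrow> lor e e = 0)"
    if d: "line_with_direction L d" for d
  proof -
    obtain k where "k \<noteq> 0" "lor d d = k\<^sup>2 * lor e e"
      using lor_direction[OF assms(1) d[unfolded L]] .
    then show ?thesis
      by (simp add: mult_less_0_iff zero_less_mult_iff)
  qed
  show "timelike_line L \<Longrightarrow> lor e e < 0"
    using * by (auto simp: timelike_line_def timelike_vec_def)
  show "spacelike_line L \<Longrightarrow> lor e e > 0"
    using * by (auto simp: spacelike_line_def spacelike_vec_def line_with_direction_def)
  show "lightlike_line L \<Longrightarrow> lor e e = 0"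
    using * by (auto simp: lightlike_line_def lightlike_vec_def)
qed

theorem theorem1p1:
  fixes M L :: "(real^3) set" and X :: "real \<Rightarrow> real \<Rightarrow> real^3" and I :: "real set"
    and a b c \<epsilon> :: real
  assumes rot: "rotational_surface L I X"
    and M: "M = surface_of I X"
    and nondeg: "nondegenerate_surface X (I \<times> UNIV)"
    and eps_spacelike: "spacelike_surface X (I \<times> UNIV) \<Longrightarrow> \<epsilon> = 1"
    and eps_timelike: "timelike_surface X (I \<times> UNIV) \<Longrightarrow> \<epsilon> = -1"
    and weingarten: "linear_weingarten \<epsilon> a b c X (I \<times> UNIV)"
    and H_not_const: "\<not> (\<lambda>(u, v). mean_curvature \<epsilon> X u v) constant_on (I \<times> UNIV)"
    and K_not_const: "\<not> (\<lambda>(u, v). gauss_curvature \<epsilon> X u v) constant_on (I \<times> UNIV)"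
    and discr: "a\<^sup>2 - 4 * b * c * \<epsilon> = 0"
  shows
    "(timelike_line L \<longrightarrow>
       (\<exists>T J z \<mu> l C s1 s2. rigid_motion T \<and> profile J z \<and> s1 \<in> {1, -1} \<and> s2 \<in> {1, -1} \<and>
          T ` M = surface_of J (\<lambda>u v. vector [u * cos v, u * sin v, z u]) \<and>
          b * \<epsilon> * (- b + l) \<ge> 0 \<and> C = 2 * sqrt (b * \<epsilon> * (- b + l)) \<and>
          (\<forall>u\<in>J. 4 * \<epsilon> * b\<^sup>2 / a\<^sup>2 + (C / a + s1 * u)\<^sup>2 \<ge> 0 \<and>
             z u = s2 * sqrt (4 * \<epsilon> * b\<^sup>2 / a\<^sup>2 + (C / a + s1 * u)\<^sup>2) + \<mu>)))
   \<and> (spacelike_line L \<longrightarrow>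
       (\<exists>T J z \<mu> l C s1 s2 s3 s4. rigid_motion T \<and> profile J z \<and>
          s1 \<in> {1, -1} \<and> s2 \<in> {1, -1} \<and> s3 \<in> {1, -1} \<and> s4 \<in> {1, -1} \<and>
          T ` M = surface_of J (\<lambda>u v. vector [u, z u * sinh v, z u * cosh v]) \<and>
          b * \<epsilon> * l \<ge> 0 \<and> C = 2 * sqrt (b * \<epsilon> * l) \<and>
          (\<forall>u\<in>J. 4 * \<epsilon> * b\<^sup>2 / a\<^sup>2 + s3 * (u + s4 * \<mu>)\<^sup>2 \<ge> 0 \<and>
             z u = s1 * (C / a) + s2 * sqrt (4 * \<epsilon> * b\<^sup>2 / a\<^sup>2 + s3 * (u + s4 * \<mu>)\<^sup>2)))
       \<or> (\<exists>T J z \<mu> l C s1 s2 s3. rigid_motion T \<and> profile J z \<and>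
          s1 \<in> {1, -1} \<and> s2 \<in> {1, -1} \<and> s3 \<in> {1, -1} \<and>
          T ` M = surface_of J (\<lambda>u v. vector [u, z u * cosh v, z u * sinh v]) \<and>
          b * l \<ge> 0 \<and> C = 2 * sqrt (b * l) \<and>
          (\<forall>u\<in>J. 4 * b\<^sup>2 / a\<^sup>2 + s2 * (u + s3 * \<mu>)\<^sup>2 \<ge> 0 \<and>
             z u = - C / a + s1 * sqrt (4 * b\<^sup>2 / a\<^sup>2 + s2 * (u + s3 * \<mu>)\<^sup>2))))
   \<and> (lightlike_line L \<longrightarrow>
       (\<exists>T J z \<mu> l C. rigid_motion T \<and> profile J z \<and>
          T ` M = surface_of J
            (\<lambda>u v. vector [- 2 * u * v, z u + u - u * v\<^sup>2, z u - u - u * v\<^sup>2]) \<and>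
          - 8 * b * \<epsilon> * l \<ge> 0 \<and> C = sqrt (- 8 * b * \<epsilon> * l) \<and> - 2 * c * l > 0 \<and>
          (\<forall>u\<in>J. 2 * l + c * u\<^sup>2 \<noteq> 0 \<longrightarrow>
             z u = 1 / 64 * ((- 4 * a * C * l + (c * C\<^sup>2 - 2 * a\<^sup>2 * l) * u)
                               / (\<epsilon> * c * l * (2 * l + c * u\<^sup>2))
                             + \<epsilon> * ((c * C\<^sup>2 + 2 * a\<^sup>2 * l) / sqrt (- 2 * c * l))
                                 * artanh (sqrt (- (c / (2 * l))) * u)) + \<mu>)))"
proof -
  have W: "nonconstant_weingarten \<epsilon> a b c X I"
    using nondeg eps_spacelike eps_timelike weingarten K_not_const discr
    by (simp add: nonconstant_weingarten_def)
  obtain \<Phi> z where \<Phi>: "rigid_motion \<Phi>" and z: "profile I z" and cases: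
     "(L = \<Phi> ` span {vector [0, 0, 1]} \<and>
         (\<forall>u\<in>I. \<forall>v. X u v = \<Phi> (rot_timelike v *v vector [u, 0, z u]))) \<or>
      (L = \<Phi> ` span {vector [1, 0, 0]} \<and>
         (\<forall>u\<in>I. \<forall>v. X u v = \<Phi> (rot_spacelike v *v vector [u, 0, z u]))) \<or>
      (L = \<Phi> ` span {vector [1, 0, 0]} \<and>
         (\<forall>u\<in>I. \<forall>v. X u v = \<Phi> (rot_spacelike v *v vector [u, z u, 0]))) \<or>
      (L = \<Phi> ` span {vector [0, 1, 1]} \<and>
         (\<forall>u\<in>I. \<forall>v. X u v = \<Phi> (rot_lightlike v *v vector [0, u + z u, - u + z u])))"
    using rot unfolding rotational_surface_def by blast
  from cases show ?thesis
  proof (elim disjE conjE)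
    assume L: "L = \<Phi> ` span {vector [0, 0, 1]}"
      and X: "\<forall>u\<in>I. \<forall>v. X u v = \<Phi> (rot_timelike v *v vector [u, 0, z u])"
    have "\<not> spacelike_line L" "\<not> lightlike_line L"
      using axis_type[OF \<Phi> L] by (auto simp: lor_def)
    with timelike_axis_normal_form[OF \<Phi> z X W] show ?thesis
      unfolding M by (simp only: simp_thms)
  next
    assume L: "L = \<Phi> ` span {vector [1, 0, 0]}"
      and X: "\<forall>u\<in>I. \<forall>v. X u v = \<Phi> (rot_spacelike v *v vector [u, 0, z u])"
    have "\<not> timelike_line L" "\<not> lightlike_line L"
      using axis_type[OF \<Phi> L] by (auto simp: lor_def)
    with spacelike_axis_normal_form_a[OF \<Phi> z X W] show ?thesis
      unfolding M by (simp only: simp_thms)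
  next
    assume L: "L = \<Phi> ` span {vector [1, 0, 0]}"
      and X: "\<forall>u\<in>I. \<forall>v. X u v = \<Phi> (rot_spacelike v *v vector [u, z u, 0])"
    have "\<not> timelike_line L" "\<not> lightlike_line L"
      using axis_type[OF \<Phi> L] by (auto simp: lor_def)
    with spacelike_axis_normal_form_b[OF \<Phi> z X W] show ?thesis
      unfolding M by (simp only: simp_thms)
  next
    assume L: "L = \<Phi> ` span {vector [0, 1, 1]}"
      and X: "\<forall>u\<in>I. \<forall>v. X u v = \<Phi> (rot_lightlike v *v vector [0, u + z u, - u + z u])"
    have "\<not> timelike_line L" "\<not> spacelike_line L"
      using axis_type[OF \<Phi> L] by (auto simp: lor_def)
    with lightlike_axis_normal_form[OF \<Phi> z X W] show ?thesis
      unfolding M by (simp only: simp_thms)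
  qed
qed

end
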